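(* There exists $h_0>0$, independent of the dimension $d$, such that for every $d\ge 4$, every choice of nonzero real forcing constants $\beta_1,\dots,\beta_d$, and every $h\in(0,h_0]$, the following holds for the random splitting $(X_n)$ of the forced and partially damped Lorenz '96 equation with Markov semigroup $(\mathcal{P}_n)$ and with $H(x)=|x|+1$: there exist constants $\alpha=\alpha(d,h)\in(0,1)$ and $f=f(d,h)>0$ (the forcing constants $\beta_i$ being regarded as fixed) such that $$\mathcal{P}_{d+1}H(x)\le \alpha H(x)+f\qquad\text{for all }x\in\mathbf{R}^d.$$
   Context: Let $d\ge4$, let $\{e_i\}_{i=1}^d$ be the standard basis of $\mathbf{R}^d$, $|\cdot|$ the Euclidean norm, and $\beta_1,\dots,\beta_d\in\mathbf{R}\setminus\{0\}$. Indices are taken modulo $d$ (so $x_{d+1}=x_1$, $x_0=x_d$, $x_{-1}=x_{d-1}$, $e_{d+1}=e_1$). Define vector fields on $\mathbf{R}^d$ $$V_i(x)=x_{i+1}x_{i-1}e_i-x_ix_{i-1}e_{i+1}\quad(i=1,\dots,d),\qquad V_\star(x)=-x_1e_1+\sum_{i=1}^d\beta_ie_i .$$ Their sum is the vector field of the Lorenz '96 equation $\dot x_i=(x_{i+1}-x_{i-2})x_{i-1}-\delta_{1i}x_i+\beta_i$, where $\delta_{1i}=1$ if $i=1$ and $0$ otherwise. Each of these fields has a globally defined flow; write $\varphi^i_t$ ($i=1,\dots,d$) and $\varphi_t^\star$ for the flow maps. Random splitting: set $m=d+1$. Let $u_n=(u_{1n},\dots,u_{mn})$, $n\ge0$, be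 i.i.d. uniformly distributed permutations of $\{1,\dots,d,\star\}$, and let $\tau_{in}$ ($1\le i\le m$, $n\ge0$) be i.i.d. exponential random variables of mean $h$, independent of the permutations. Define the Markov chain $(X_n)$ on $\mathbf{R}^d$ by $$X_{n+1}=\varphi^{u_{mn}}_{\tau_{mn}}\circ\cdots\circ\varphi^{u_{1n}}_{\tau_{1n}}(X_n).$$ For measurable $\phi\ge 0$, $\mathcal{P}_n\phi(x)=\mathbf{E}_x\phi(X_n)$, where the subscript $x$ means $X_0=x$. *)

theory Defs
  imports "HOL-Probability.Probability" "HOL-Combinatorics.Multiset_Permutations"
begin

text \<open>
  Since the dimension \<open>d\<close> is quantified inside the statement, \<open>\<real>\<^sup>d\<close> is the set of functions
  \<open>{1..d} \<rightarrow> \<real>\<close>, extended by the value \<open>undefined\<close> outside \<open>{1..d}\<close>.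
\<close>

definition Rd :: "nat \<Rightarrow> (nat \<Rightarrow> real) set" where
  "Rd d = {1..d} \<rightarrow>\<^sub>E UNIV"

definition Rd_norm :: "nat \<Rightarrow> (nat \<Rightarrow> real) \<Rightarrow> real" where
  "Rd_norm d x = L2_set x {1..d}"

text \<open>The representative in \<open>{1..d}\<close> of \<open>k\<close> modulo \<open>d\<close>.\<close>

definition cyc :: "nat \<Rightarrow> nat \<Rightarrow> nat" where
  "cyc d k = (k + d - 1) mod d + 1"

definition basis_vec :: "nat \<Rightarrow> nat \<Rightarrow> real" where
  "basis_vec i = (\<lambda>j. if j = i then 1 else 0)"

datatype field_label = Coord nat | Star

definition labels :: "nat \<Rightarrow> field_label set" where
  "labels d = insert Star (Coord ` {1..d})"

fun split_field ::
  "nat \<Rightarrow> (nat \<Rightarrow> real) \<Rightarrow> field_label \<Rightarrow> (nat \<Rightarrow> real) \<Rightarrow> nat \<Rightarrow> real" where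
  "split_field d \<beta> (Coord i) x =
     (\<lambda>j\<in>{1..d}. x (cyc d (i + 1)) * x (cyc d (i - 1)) * basis_vec i j
                - x i * x (cyc d (i - 1)) * basis_vec (cyc d (i + 1)) j)"
| "split_field d \<beta> Star x =
     (\<lambda>j\<in>{1..d}. - x 1 * basis_vec 1 j + (\<Sum>i=1..d. \<beta> i * basis_vec i j))"

definition integral_curve ::
  "nat \<Rightarrow> ((nat \<Rightarrow> real) \<Rightarrow> nat \<Rightarrow> real) \<Rightarrow> (nat \<Rightarrow> real) \<Rightarrow> (real \<Rightarrow> nat \<Rightarrow> real) \<Rightarrow> bool" where
  "integral_curve d V x c \<longleftrightarrow>
     c 0 = x \<and> (\<forall>t. c t \<in> Rd d) \<and>
     (\<forall>t. \<forall>j\<in>{1..d}. ((\<lambda>s. c s j) has_real_derivative V (c t) j) (at t))"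

text \<open>
  The global flow of \<open>V\<close>. For the fields \<open>split_field d \<beta> l\<close> and starting points in \<open>Rd d\<close>
  the description is proper, by \<open>ex1_integral_curve\<close> below.
\<close>

definition flow ::
  "nat \<Rightarrow> ((nat \<Rightarrow> real) \<Rightarrow> nat \<Rightarrow> real) \<Rightarrow> real \<Rightarrow> (nat \<Rightarrow> real) \<Rightarrow> nat \<Rightarrow> real" where
  "flow d V t x = (THE c. integral_curve d V x c) t"

text \<open>
  The noise \<open>(u\<^sub>n, \<tau>\<^sub>n)\<close>, \<open>n \<ge> 0\<close>, on its canonical space: \<open>u\<^sub>n\<close> is a uniformly distributed
  enumeration (without repetition) of the \<open>d + 1\<close> labels, and \<open>\<tau>\<^sub>n\<close> consists of \<open>d + 1\<close>
  independent exponential times of mean \<open>h\<close>, that is, of rate \<open>1 / h\<close>. Positions within a step are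
  counted from \<open>0\<close>, so that \<open>u\<^sub>n ! k\<close> is the index written \<open>u\<^sub>i\<^sub>n\<close> with \<open>i = k + 1\<close>, and likewise
  for the times.
\<close>

type_synonym step_noise = "field_label list \<times> (nat \<Rightarrow> real)"

definition step_noise :: "nat \<Rightarrow> real \<Rightarrow> step_noise measure" where
  "step_noise d h =
     measure_pmf (pmf_of_set (permutations_of_set (labels d))) \<Otimes>\<^sub>M
     (\<Pi>\<^sub>M k\<in>{..<d + 1}. density lborel (\<lambda>t. ennreal (exponential_density (1 / h) t)))"

definition noise :: "nat \<Rightarrow> real \<Rightarrow> (nat \<Rightarrow> step_noise) measure" where
  "noise d h = (\<Pi>\<^sub>M n\<in>UNIV. step_noise d h)"

definition split_step ::
  "nat \<Rightarrow> (nat \<Rightarrow> real) \<Rightarrow> step_noise \<Rightarrow> (nat \<Rightarrow> real) \<Rightarrow> nat \<Rightarrow> real" where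
  "split_step d \<beta> = (\<lambda>(u, \<tau>). fold (\<lambda>k. flow d (split_field d \<beta> (u ! k)) (\<tau> k)) [0..<d + 1])"

primrec chain ::
  "nat \<Rightarrow> (nat \<Rightarrow> real) \<Rightarrow> (nat \<Rightarrow> step_noise) \<Rightarrow> (nat \<Rightarrow> real) \<Rightarrow> nat \<Rightarrow> nat \<Rightarrow> real" where
  "chain d \<beta> \<omega> x 0 = x"
| "chain d \<beta> \<omega> x (Suc n) = split_step d \<beta> (\<omega> n) (chain d \<beta> \<omega> x n)"

definition markov_semigroup ::
  "nat \<Rightarrow> (nat \<Rightarrow> real) \<Rightarrow> real \<Rightarrow> nat \<Rightarrow> ((nat \<Rightarrow> real) \<Rightarrow> ennreal) \<Rightarrow> (nat \<Rightarrow> real) \<Rightarrow> ennreal" where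
  "markov_semigroup d \<beta> h n \<phi> x = (\<integral>\<^sup>+ \<omega>. \<phi> (chain d \<beta> \<omega> x n) \<partial>noise d h)"

definition lyapunov :: "nat \<Rightarrow> (nat \<Rightarrow> real) \<Rightarrow> real" where
  "lyapunov d x = Rd_norm d x + 1"


lemma cyc_in: "d > 0 \<Longrightarrow> cyc d k \<in> {1..d}"
  by (simp add: cyc_def Suc_leI)

lemma cyc_simps:
  assumes "d \<ge> 2" "i \<in> {1..d}"
  shows "cyc d (i + 1) = (if i = d then 1 else i + 1)"
    and "cyc d (i - 1) = (if i = 1 then d else i - 1)"
proof -
  show "cyc d (i + 1) = (if i = d then 1 else i + 1)"
    using assms by (auto simp: cyc_def)
  show "cyc d (i - 1) = (if i = 1 then d else i - 1)"
  proof (cases "i = 1")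
    case False
    with assms have "i - 1 + d - 1 = (i - 2) + d" "i - 2 < d" "i \<ge> 2" by auto
    then have "cyc d (i - 1) = i - 2 + 1" unfolding cyc_def by (metis mod_add_self2 mod_less)
    with False \<open>i \<ge> 2\<close> show ?thesis by simp
  qed (use assms in \<open>auto simp: cyc_def\<close>)
qed

text \<open>The sum of the fields is the Lorenz '96 vector field, damped in the first coordinate.\<close>

lemma sum_split_field:
  assumes d: "d \<ge> 4" and j: "j \<in> {1..d}"
  shows "(\<Sum>l\<in>labels d. split_field d \<beta> l x j) =
           (x (cyc d (j + 1)) - x (cyc d (j + d - 2))) * x (cyc d (j - 1))
           - (if j = 1 then x j else 0) + \<beta> j"
proof -
  let ?p = "cyc d (j - 1)"
  have p: "?p \<in> {1..d}" using d by (intro cyc_in) simp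
  have next_iff: "j = cyc d (i + 1) \<longleftrightarrow> i = ?p" if "i \<in> {1..d}" for i
    using d j that cyc_simps[OF _ j] cyc_simps[OF _ that] by (auto split: if_splits)
  have pp: "cyc d (?p - 1) = cyc d (j + d - 2)"
  proof -
    consider "j = 1" | "j = 2" | "j \<ge> 3" using j by force
    then show ?thesis
    proof cases
      case 3
      then have "j + d - 2 + d - 1 = (j - 3) + d + d" "j - 3 < d" using j d by auto
      then have "cyc d (j + d - 2) = j - 3 + 1"
        unfolding cyc_def by (metis mod_add_self2 mod_less)
      with 3 j d show ?thesis using cyc_simps(2)[OF _ j] cyc_simps(2)[OF _ p]
        by (auto split: if_splits)
    next
      case 1
      with d have "j + d - 2 + d - 1 = (d - 2) + d" "d - 2 < d" by simp_all
      then have "cyc d (j + d - 2) = d - 2 + 1"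
        unfolding cyc_def by (metis mod_add_self2 mod_less)
      with 1 d show ?thesis using cyc_simps(2)[OF _ j] cyc_simps(2)[OF _ p]
        by (auto split: if_splits)
    next
      case 2
      with d have "j + d - 2 + d - 1 = (d - 1) + d" "d - 1 < d" by simp_all
      then have "cyc d (j + d - 2) = d - 1 + 1"
        unfolding cyc_def by (metis mod_add_self2 mod_less)
      with 2 d show ?thesis using cyc_simps(2)[OF _ j] cyc_simps(2)[OF _ p]
        by (auto split: if_splits)
    qed
  qed
  have "(\<Sum>l\<in>labels d. split_field d \<beta> l x j) =
        split_field d \<beta> Star x j + (\<Sum>i=1..d. split_field d \<beta> (Coord i) x j)"
    unfolding labels_def by (subst sum.insert) (auto simp: sum.reindex inj_on_def)
  also have "(\<Sum>i=1..d. split_field d \<beta> (Coord i) x j) =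
      (\<Sum>i=1..d. if i = j then x (cyc d (i + 1)) * x (cyc d (i - 1)) else 0)
      - (\<Sum>i=1..d. if i = ?p then x i * x (cyc d (i - 1)) else 0)"
    unfolding sum_subtractf [symmetric]
  proof (intro sum.cong refl)
    fix i assume i: "i \<in> {1..d}"
    show "split_field d \<beta> (Coord i) x j =
        (if i = j then x (cyc d (i + 1)) * x (cyc d (i - 1)) else 0)
        - (if i = ?p then x i * x (cyc d (i - 1)) else 0)"
      unfolding next_iff[OF i, symmetric] using j by (auto simp: basis_vec_def)
  qed
  also have "\<dots> = x (cyc d (j + 1)) * x ?p - x ?p * x (cyc d (j + d - 2))"
    using j p by (simp add: pp[unfolded One_nat_def])
  also have "split_field d \<beta> Star x j = - (if j = 1 then x j else 0) + \<beta> j"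
  proof -
    have "(\<Sum>i=1..d. \<beta> i * basis_vec i j) = (\<Sum>i=1..d. if i = j then \<beta> i else 0)"
      by (intro sum.cong) (auto simp: basis_vec_def)
    then show ?thesis using j by (simp add: basis_vec_def)
  qed
  finally show ?thesis by (simp add: algebra_simps)
qed

lemma ex1_integral_curve:
  assumes d: "d \<ge> 4" and l: "l \<in> labels d" and x: "x \<in> Rd d"
  shows "\<exists>!c. integral_curve d (split_field d \<beta> l) x c"
proof (cases l)
  case (Coord i)
  with l have i: "i \<in> {1..d}" by (auto simp: labels_def)
  define n p where "n = cyc d (i + 1)" and "p = cyc d (i - 1)"
  have np: "n \<noteq> i" "p \<noteq> i" "p \<noteq> n" "n \<in> {1..d}" "p \<in> {1..d}"
    using d i cyc_simps[OF _ i] cyc_in[of d "i + 1"] cyc_in[of d "i - 1"]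
    unfolding n_def p_def by (auto split: if_splits)
  have V: "split_field d \<beta> l y j =
      (if j = i then y n * y p else if j = n then - (y i * y p) else 0)" if "j \<in> {1..d}" for y j
    using that np by (auto simp: Coord basis_vec_def n_def p_def)
  define a where "a = x p"
  define C where "C t = (\<lambda>j\<in>{1..d}. if j = i then x i * cos (a * t) + x n * sin (a * t)
     else if j = n then x n * cos (a * t) - x i * sin (a * t) else x j)" for t
  show ?thesis
  proof (rule ex1I[of _ C])
    have "C 0 = x"
      using x by (auto simp: C_def Rd_def fun_eq_iff PiE_def extensional_def)
    moreover have "C t \<in> Rd d" for t by (auto simp: C_def Rd_def)
    moreover have "((\<lambda>s. C s j) has_real_derivative split_field d \<beta> l (C t) j) (at t)"
      if j: "j \<in> {1..d}" for t j
    proof -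
      consider "j = i" | "j = n" | "j \<noteq> i" "j \<noteq> n" by blast
      then show ?thesis
      proof cases
        case 1
        show ?thesis unfolding V[OF j] using np j 1 i
          by (auto simp: C_def a_def intro!: derivative_eq_intros) (auto simp: algebra_simps)
      next
        case 2
        show ?thesis unfolding V[OF j] using np j 2 i
          by (auto simp: C_def a_def intro!: derivative_eq_intros) (auto simp: algebra_simps)
      next
        case 3
        then show ?thesis unfolding V[OF j] using np j by (auto simp: C_def)
      qed
    qed
    ultimately show "integral_curve d (split_field d \<beta> l) x C"
      by (auto simp: integral_curve_def)
  next
    fix c assume c: "integral_curve d (split_field d \<beta> l) x c"
    have c0: "c 0 = x" and cR: "c t \<in> Rd d" for t
      using c by (auto simp: integral_curve_def)
    have D: "((\<lambda>s. c s j) has_real_derivative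
        (if j = i then c t n * c t p else if j = n then - (c t i * c t p) else 0)) (at t)"
      if "j \<in> {1..d}" for j t
      using c that unfolding integral_curve_def V[OF that, symmetric] by blast
    have const: "c t j = x j" if "j \<in> {1..d}" "j \<noteq> i" "j \<noteq> n" for t j
      using DERIV_isconst_all[of "\<lambda>s. c s j" t 0] D[OF that(1)] that c0 by auto
    have Di: "((\<lambda>s. c s i) has_real_derivative c t n * a) (at t)"
     and Dn: "((\<lambda>s. c s n) has_real_derivative - (c t i * a)) (at t)" for t
      using D[of i t] D[of n t] i np const[of p t] by (auto simp: a_def)
    have 1: "c t i * cos (a * t) - c t n * sin (a * t) = x i" for t
    proof -
      have "((\<lambda>s. c s i * cos (a * s) - c s n * sin (a * s)) has_real_derivative 0) (at t)" for t
        by (auto intro!: derivative_eq_intros Di Dn simp: algebra_simps)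
      from DERIV_isconst_all[OF allI[OF this], of t 0] show ?thesis by (simp add: c0)
    qed
    have 2: "c t i * sin (a * t) + c t n * cos (a * t) = x n" for t
    proof -
      have "((\<lambda>s. c s i * sin (a * s) + c s n * cos (a * s)) has_real_derivative 0) (at t)" for t
        by (auto intro!: derivative_eq_intros Di Dn simp: algebra_simps)
      from DERIV_isconst_all[OF allI[OF this], of t 0] show ?thesis by (simp add: c0)
    qed
    have sc: "cos (a * t) * cos (a * t) = 1 - sin (a * t) * sin (a * t)" for t
      using sin_cos_squared_add[of "a * t"] by (simp add: power2_eq_square)
    have "c t i = x i * cos (a * t) + x n * sin (a * t)"
         "c t n = x n * cos (a * t) - x i * sin (a * t)" for t
      unfolding 1[of t, symmetric] 2[of t, symmetric]
      using sc[of t] by (algebra, algebra)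
    with const have "c t j = C t j" if "j \<in> {1..d}" for t j
      using that by (auto simp: C_def)
    moreover have "c t j = C t j" if "j \<notin> {1..d}" for t j
      using that cR[of t] by (auto simp: C_def Rd_def PiE_def extensional_def)
    ultimately show "c = C" by (intro ext) blast
  qed
next
  case Star
  have V: "split_field d \<beta> l y j = (if j = 1 then - y 1 else 0) + \<beta> j" if "j \<in> {1..d}" for y j
  proof -
    have "(\<Sum>i=1..d. \<beta> i * basis_vec i j) = (\<Sum>i=1..d. if i = j then \<beta> i else 0)"
      by (intro sum.cong) (auto simp: basis_vec_def)
    then show ?thesis using that by (simp add: Star basis_vec_def)
  qed
  define C where "C t = (\<lambda>j\<in>{1..d}. if j = 1 then \<beta> 1 + (x 1 - \<beta> 1) * exp (- t)
     else x j + \<beta> j * t)" for t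
  show ?thesis
  proof (rule ex1I[of _ C])
    have "C 0 = x"
      using x by (auto simp: C_def Rd_def fun_eq_iff PiE_def extensional_def)
    moreover have "C t \<in> Rd d" for t by (auto simp: C_def Rd_def)
    moreover have "((\<lambda>s. C s j) has_real_derivative split_field d \<beta> l (C t) j) (at t)"
      if j: "j \<in> {1..d}" for t j
      unfolding V[OF j] using j d
      by (cases "j = 1") (auto simp: C_def intro!: derivative_eq_intros)
    ultimately show "integral_curve d (split_field d \<beta> l) x C"
      by (auto simp: integral_curve_def)
  next
    fix c assume c: "integral_curve d (split_field d \<beta> l) x c"
    have c0: "c 0 = x" and cR: "c t \<in> Rd d" for t
      using c by (auto simp: integral_curve_def)
    have D: "((\<lambda>s. c s j) has_real_derivative (if j = 1 then - c t 1 else 0) + \<beta> j) (at t)"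
      if "j \<in> {1..d}" for j t
      using c that unfolding integral_curve_def V[OF that, symmetric] by blast
    have "c t j = C t j" if j: "j \<in> {1..d}" for t j
    proof (cases "j = 1")
      case True
      have D1: "((\<lambda>s. c s 1) has_real_derivative \<beta> 1 - c t 1) (at t)" for t
        using D[of 1 t] d by simp
      have "((\<lambda>s. (c s 1 - \<beta> 1) * exp s) has_real_derivative 0) (at t)" for t
        by (auto intro!: derivative_eq_intros D1[unfolded One_nat_def] simp: algebra_simps)
      from DERIV_isconst_all[OF allI[OF this], of t 0]
      have "(c t 1 - \<beta> 1) * exp t = x 1 - \<beta> 1" by (simp add: c0)
      then have "c t 1 = \<beta> 1 + (x 1 - \<beta> 1) * exp (- t)"
        by (simp add: exp_minus field_simps)
      with True j show ?thesis by (simp add: C_def)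
    next
      case False
      have "((\<lambda>s. c s j - \<beta> j * s) has_real_derivative 0) (at t)" for t
        using False D[OF j] by (auto intro!: derivative_eq_intros)
      from DERIV_isconst_all[OF allI[OF this], of t 0]
      have "c t j = x j + \<beta> j * t" by (simp add: c0)
      with False j show ?thesis by (simp add: C_def)
    qed
    moreover have "c t j = C t j" if "j \<notin> {1..d}" for t j
      using that cR[of t] by (auto simp: C_def Rd_def PiE_def extensional_def)
    ultimately show "c = C" by (intro ext) blast
  qed
qed

end

theory Submission
  imports Defs
begin

text \<open>
  The flows of the fields \<open>V\<^sub>i\<close> are rotations in the plane of the coordinates \<open>i\<close> and \<open>i + 1\<close>, with
  angular speed \<open>x\<^sub>i\<^sub>-\<^sub>1\<close>; they preserve the norm. The flow of \<open>V\<^sub>\<star>\<close> contracts the first coordinate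
  and translates by an amount of size at most \<open>|\<beta>| t\<close>. Hence the norm grows by a bounded amount per
  step on average, and it decreases by a fixed proportion as soon as a fixed proportion of the mass
  \<open>|x|\<close> sits in the first coordinate. Measure this by the shares \<open>x\<^sub>j\<^sup>2 / |x|\<close>, whose sum is \<open>|x|\<close>.

  Three estimates carry the proof, each up to an additive constant that does not depend on \<open>x\<close>.
  (a) Dissipation (\<open>P_norm\<close>): one step lowers the mean norm by at least a multiple of the first share.
  (b) Persistence (\<open>feeds_P_keep\<close>): the mean of each share after a step is at least a multiple of the
  share before it. (c) Transfer (\<open>feeds_P_transfer\<close>): for \<open>k \<noteq> 1\<close>, the mean of share \<open>k + 1\<close> after a
  step is at least a multiple of share \<open>k\<close> before it.

  For (b) and (c) the second moment of a rotated coordinate at an exponential time has a closed form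
  (\<open>second_moment_random_rotation\<close>). It shows at once that a rotation at worst halves each mean share,
  whatever its speed, and that the rotation \<open>i\<close> moves a share from \<open>i\<close> to \<open>i + 1\<close> at a rate that is
  bounded below as long as \<open>|x\<^sub>i\<^sub>-\<^sub>1|\<close> is. The speed may vanish, for instance at multiples of a basis
  vector, which are equilibria of all the rotations. This is where the forcing enters: run for an
  exponential time just before the rotation, the flow of \<open>V\<^sub>\<star>\<close> moves \<open>x\<^sub>i\<^sub>-\<^sub>1\<close> away from \<open>0\<close> with
  probability bounded below uniformly in \<open>x\<close> (\<open>drift_leaves_zero\<close>), because \<open>\<beta>\<^sub>i\<^sub>-\<^sub>1 \<noteq> 0\<close>.

  Each of the \<open>(d + 1)!\<close> orders within a step has positive probability, so it suffices to
  treat one favourable order. After \<open>d\<close> steps every share has fed the first one, by at most \<open>d - 1\<close>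
  transfers around the circle and some persistence (\<open>feeds_P_pow\<close>); so the mean first share is then at
  least a multiple of \<open>|x|\<close>, and dissipation in one more step yields the contraction.

  All integrands are nonnegative, so the estimates are stated for integrals with values in
  \<open>[0, \<infinity>]\<close>, with every term on the side where it enters positively.
\<close>

section \<open>Markov operators and lower estimates\<close>

text \<open>
  Only these algebraic properties of an average over a random map are needed below. They are stable
  under composition, which makes it possible to treat the flows, the steps and the iterated steps in
  the same way.
\<close>

locale markov_operator =
  fixes S :: "'a measure" and Q :: "('a \<Rightarrow> ennreal) \<Rightarrow> 'a \<Rightarrow> ennreal"
  assumes measurable_apply: "\<phi> \<in> borel_measurable S \<Longrightarrow> Q \<phi> \<in> borel_measurable S"
    and mono: "(\<And>y. y \<in> space S \<Longrightarrow> \<phi> y \<le> \<psi> y) \<Longrightarrow> x \<in> space S \<Longrightarrow> Q \<phi> x \<le> Q \<psi> x"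
    and add: "\<phi> \<in> borel_measurable S \<Longrightarrow> \<psi> \<in> borel_measurable S \<Longrightarrow> x \<in> space S \<Longrightarrow>
      Q (\<lambda>y. \<phi> y + \<psi> y) x = Q \<phi> x + Q \<psi> x"
    and scale: "\<phi> \<in> borel_measurable S \<Longrightarrow> x \<in> space S \<Longrightarrow> Q (\<lambda>y. a * \<phi> y) x = a * Q \<phi> x"
    and const: "x \<in> space S \<Longrightarrow> Q (\<lambda>y. a) x = a"
begin

lemma cong:
  assumes "\<And>y. y \<in> space S \<Longrightarrow> \<phi> y = \<psi> y" "x \<in> space S"
  shows "Q \<phi> x = Q \<psi> x"
  using assms by (intro antisym mono) auto

end

lemma markov_operator_id: "markov_operator S (\<lambda>\<phi>. \<phi>)"
  by unfold_locales auto

lemma markov_operator_comp: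
  assumes "markov_operator S Q" "markov_operator S R"
  shows "markov_operator S (\<lambda>\<phi>. Q (R \<phi>))"
proof -
  interpret Q: markov_operator S Q by fact
  interpret R: markov_operator S R by fact
  show ?thesis
  proof
    fix \<phi> \<psi> :: "'a \<Rightarrow> ennreal" and x a
    assume m: "\<phi> \<in> borel_measurable S"
    show "Q (R \<phi>) \<in> borel_measurable S" by (intro Q.measurable_apply R.measurable_apply m)
    assume x: "x \<in> space S"
    show "Q (R (\<lambda>y. a * \<phi> y)) x = a * Q (R \<phi>) x"
      using x m by (simp add: R.scale Q.scale R.measurable_apply cong: Q.cong)
    assume m': "\<psi> \<in> borel_measurable S"
    show "Q (R (\<lambda>y. \<phi> y + \<psi> y)) x = Q (R \<phi>) x + Q (R \<psi>) x"
      using x m m' by (simp add: R.add Q.add R.measurable_apply cong: Q.cong)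
  next
    fix x a assume "x \<in> space S"
    then show "Q (R (\<lambda>y. a)) x = a" by (simp add: R.const Q.const cong: Q.cong)
  qed (intro Q.mono R.mono; auto)
qed

lemma markov_operator_foldr:
  assumes "\<And>l. l \<in> set ls \<Longrightarrow> markov_operator S (K l)"
  shows "markov_operator S (foldr K ls)"
  using assms
proof (induction ls)
  case Nil
  then show ?case using markov_operator_id[of S] by (simp add: id_def)
next
  case (Cons l ls)
  then show ?case using markov_operator_comp[of S "K l" "foldr K ls"] by (simp add: o_def)
qed

lemma markov_operator_funpow:
  assumes "markov_operator S Q"
  shows "markov_operator S (Q ^^ n)"
proof (induction n)
  case 0
  then show ?case using markov_operator_id[of S] by (simp add: id_def)
next
  case (Suc n)
  then show ?case using markov_operator_comp[OF assms] by (simp add: o_def)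
qed

definition avg :: "'b measure \<Rightarrow> ('b \<Rightarrow> 'a \<Rightarrow> 'a) \<Rightarrow> ('a \<Rightarrow> ennreal) \<Rightarrow> 'a \<Rightarrow> ennreal" where
  "avg M F \<phi> x = (\<integral>\<^sup>+ z. \<phi> (F z x) \<partial>M)"

lemma markov_operator_avg:
  fixes S :: "'a measure" and F :: "'b \<Rightarrow> 'a \<Rightarrow> 'a"
  assumes M: "prob_space M" and [measurable]: "(\<lambda>(z, x). F z x) \<in> M \<Otimes>\<^sub>M S \<rightarrow>\<^sub>M S"
  shows "markov_operator S (avg M F)"
proof -
  interpret prob_space M by fact
  have F: "F z x \<in> space S" if "z \<in> space M" "x \<in> space S" for z x
    using measurable_space[OF assms(2), of "(z, x)"] that by (simp add: space_pair_measure)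
  have Fx [measurable]: "(\<lambda>z. F z x) \<in> M \<rightarrow>\<^sub>M S" if "x \<in> space S" for x
    using measurable_compose[OF measurable_Pair2' assms(2), of x] that by simp
  have [measurable]: "(\<lambda>z. \<phi> (F z x)) \<in> borel_measurable M"
    if "x \<in> space S" "\<phi> \<in> borel_measurable S" for x and \<phi> :: "'a \<Rightarrow> ennreal"
    using that(2) Fx[OF that(1)] by measurable
  show ?thesis
  proof
    fix \<phi> :: "'a \<Rightarrow> ennreal" assume [measurable]: "\<phi> \<in> borel_measurable S"
    have "(\<lambda>(x, z). F z x) \<in> S \<Otimes>\<^sub>M M \<rightarrow>\<^sub>M S"
      using measurable_compose[OF measurable_pair_swap' assms(2)] by (simp add: case_prod_beta)
    then have "(\<lambda>(x, z). \<phi> (F z x)) \<in> borel_measurable (S \<Otimes>\<^sub>M M)"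
      by (simp add: case_prod_beta)
    then show "avg M F \<phi> \<in> borel_measurable S"
      unfolding avg_def by (rule borel_measurable_nn_integral)
  qed (auto simp: avg_def nn_integral_add nn_integral_cmult emeasure_space_1 F intro!: nn_integral_mono)
qed

text \<open>
  Read with \<open>\<phi>\<close> and \<open>\<psi>\<close> as amounts stored in two places, the relation says that the mean amount
  in place \<open>\<psi>\<close> after the random motion \<open>Q\<close> is at least a fixed fraction of the amount in place \<open>\<phi>\<close>
  before it, up to an additive error. Leaving the two constants existential makes such estimates compose
  without bookkeeping.
\<close>

definition feeds ::
  "'a measure \<Rightarrow> (('a \<Rightarrow> ennreal) \<Rightarrow> 'a \<Rightarrow> ennreal) \<Rightarrow> ('a \<Rightarrow> ennreal) \<Rightarrow> ('a \<Rightarrow> ennreal) \<Rightarrow> bool" where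
  "feeds S Q \<phi> \<psi> \<longleftrightarrow>
     (\<exists>c C :: real. c > 0 \<and> (\<forall>x\<in>space S. ennreal c * \<phi> x \<le> Q \<psi> x + ennreal C))"

lemma feedsI:
  assumes "c > 0" "\<And>x. x \<in> space S \<Longrightarrow> ennreal c * \<phi> x \<le> Q \<psi> x + ennreal C"
  shows "feeds S Q \<phi> \<psi>"
  using assms unfolding feeds_def by blast

lemma feeds_id: "feeds S (\<lambda>\<phi>. \<phi>) \<phi> \<phi>"
  by (rule feedsI[of 1 _ _ _ _ 0]) auto

lemma feeds_comp:
  assumes "markov_operator S Q" "markov_operator S R"
    and Q: "feeds S Q \<phi> \<psi>" and R: "feeds S R \<psi> \<rho>"
    and [measurable]: "\<psi> \<in> borel_measurable S" "\<rho> \<in> borel_measurable S"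
  shows "feeds S (\<lambda>\<phi>. Q (R \<phi>)) \<phi> \<rho>"
proof -
  interpret Q: markov_operator S Q by fact
  interpret R: markov_operator S R by fact
  obtain c C where c: "c > 0" "\<And>x. x \<in> space S \<Longrightarrow> ennreal c * \<phi> x \<le> Q \<psi> x + ennreal C"
    using Q unfolding feeds_def by blast
  obtain c' C' where c': "c' > 0" "\<And>x. x \<in> space S \<Longrightarrow> ennreal c' * \<psi> x \<le> R \<rho> x + ennreal C'"
    using R unfolding feeds_def by blast
  note [measurable] = R.measurable_apply
  show ?thesis
  proof (rule feedsI)
    show "c' * c > 0" using c c' by simp
    fix x assume x: "x \<in> space S"
    have "ennreal (c' * c) * \<phi> x = ennreal c' * (ennreal c * \<phi> x)"
      using c(1) c'(1) by (simp add: ennreal_mult mult.assoc)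
    also have "\<dots> \<le> ennreal c' * (Q \<psi> x + ennreal C)" by (intro mult_left_mono c(2) x) simp
    also have "\<dots> = Q (\<lambda>y. ennreal c' * \<psi> y) x + ennreal c' * ennreal C"
      using x by (simp add: Q.scale ring_distribs)
    also have "\<dots> \<le> Q (\<lambda>y. R \<rho> y + ennreal C') x + ennreal c' * ennreal C"
      by (intro add_mono Q.mono c'(2) x) auto
    also have "\<dots> = Q (R \<rho>) x + (ennreal (max 0 C') + ennreal (c' * max 0 C))"
      using x c'(1) by (simp add: Q.add Q.const ennreal_mult ennreal_max_0 add.assoc)
    also have "\<dots> = Q (R \<rho>) x + ennreal (max 0 C' + c' * max 0 C)"
      using c'(1) by (subst ennreal_plus) auto
    finally show "ennreal (c' * c) * \<phi> x \<le> Q (R \<rho>) x + ennreal (max 0 C' + c' * max 0 C)" .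
  qed
qed

lemma feeds_foldr:
  assumes "\<And>l. l \<in> set ls \<Longrightarrow> markov_operator S (K l)" "\<And>l. l \<in> set ls \<Longrightarrow> feeds S (K l) \<phi> \<phi>"
    and "\<phi> \<in> borel_measurable S"
  shows "feeds S (foldr K ls) \<phi> \<phi>"
  using assms
proof (induction ls)
  case Nil
  then show ?case using feeds_id[of S] by (simp add: id_def)
next
  case (Cons l ls)
  then have "feeds S (\<lambda>\<psi>. K l (foldr K ls \<psi>)) \<phi> \<phi>"
    using feeds_comp[OF Cons.prems(1) markov_operator_foldr[of ls S K], of l \<phi> \<phi> \<phi>] by simp
  then show ?case by (simp add: o_def)
qed

lemma feeds_add:
  assumes "feeds S Q \<phi> \<rho>" "feeds S Q \<psi> \<rho>"
  shows "feeds S Q (\<lambda>x. \<phi> x + \<psi> x) \<rho>"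
proof -
  obtain a A where a: "a > 0" "\<And>x. x \<in> space S \<Longrightarrow> ennreal a * \<phi> x \<le> Q \<rho> x + ennreal A"
    using assms(1) unfolding feeds_def by blast
  obtain b B where b: "b > 0" "\<And>x. x \<in> space S \<Longrightarrow> ennreal b * \<psi> x \<le> Q \<rho> x + ennreal B"
    using assms(2) unfolding feeds_def by blast
  define c where "c = min a b"
  have half: "ennreal (1 / 2) * (z + z) = z" for z
  proof -
    have "ennreal (1 / 2) * (z + z) = (ennreal (1 / 2) + ennreal (1 / 2)) * z" by (simp only: ring_distribs)
    also have "ennreal (1 / 2) + ennreal (1 / 2) = 1" by (subst ennreal_plus[symmetric]) (auto simp del: ennreal_plus)
    finally show ?thesis by simp
  qed
  show ?thesis
  proof (rule feedsI)
    show "1 / 2 * c > 0" using a b by (simp add: c_def)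
    fix x assume x: "x \<in> space S"
    have "ennreal (1 / 2 * c) * (\<phi> x + \<psi> x) = ennreal (1 / 2) * (ennreal c * \<phi> x + ennreal c * \<psi> x)"
      using a b by (subst ennreal_mult') (auto simp: c_def mult.assoc distrib_left)
    also have "\<dots> \<le> ennreal (1 / 2) * (ennreal a * \<phi> x + ennreal b * \<psi> x)"
      by (intro mult_left_mono add_mono mult_right_mono ennreal_leI) (auto simp: c_def)
    also have "\<dots> \<le> ennreal (1 / 2) * ((Q \<rho> x + ennreal (max A B)) + (Q \<rho> x + ennreal (max A B)))"
      by (intro mult_left_mono add_mono order_trans[OF a(2)[OF x]] order_trans[OF b(2)[OF x]] ennreal_leI) auto
    also have "\<dots> = Q \<rho> x + ennreal (max A B)" by (rule half)
    finally show "ennreal (1 / 2 * c) * (\<phi> x + \<psi> x) \<le> Q \<rho> x + ennreal (max A B)" .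
  qed
qed

lemma feeds_sum:
  assumes "finite I" "\<And>i. i \<in> I \<Longrightarrow> feeds S Q (\<phi> i) \<rho>"
  shows "feeds S Q (\<lambda>x. \<Sum>i\<in>I. \<phi> i x) \<rho>"
  using assms
proof (induction I)
  case empty
  then show ?case by (intro feedsI[of 1]) auto
next
  case (insert i I)
  then show ?case by (simp add: feeds_add)
qed

section \<open>Exponential waiting times\<close>

definition waiting_time :: "real \<Rightarrow> real measure" where
  "waiting_time h = density lborel (\<lambda>t. ennreal (exponential_density (1 / h) t))"

lemma sets_waiting_time [measurable_cong]: "sets (waiting_time h) = sets borel"
  by (simp add: waiting_time_def)

lemma space_waiting_time [simp]: "space (waiting_time h) = UNIV"
  by (simp add: waiting_time_def)

lemma prob_space_waiting_time: "h > 0 \<Longrightarrow> prob_space (waiting_time h)"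
  unfolding waiting_time_def by (rule prob_space_exponential_density) simp

lemma nn_integral_waiting_time:
  assumes [measurable]: "f \<in> borel_measurable borel"
  shows "(\<integral>\<^sup>+ t. f t \<partial>waiting_time h) =
    (\<integral>\<^sup>+ t. ennreal (1 / h * exp (- t / h)) * f t * indicator {0..} t \<partial>lborel)"
  unfolding waiting_time_def
  by (subst nn_integral_density)
     (auto simp: exponential_density_def indicator_def intro!: nn_integral_cong)

lemma nn_integral_waiting_time_mono:
  assumes [measurable]: "f \<in> borel_measurable borel" "g \<in> borel_measurable borel"
    and "\<And>t. t \<ge> 0 \<Longrightarrow> f t \<le> g t"
  shows "(\<integral>\<^sup>+ t. f t \<partial>waiting_time h) \<le> (\<integral>\<^sup>+ t. g t \<partial>waiting_time h)"
  using assms by (auto simp: nn_integral_waiting_time indicator_def intro!: nn_integral_mono mult_left_mono)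

text \<open>
  All explicit means below come from antiderivatives that vanish at infinity.
\<close>

lemma nn_integral_waiting_time_FTC:
  assumes h: "h > 0" and [measurable]: "g \<in> borel_measurable borel"
    and nonneg: "\<And>t. t \<ge> 0 \<Longrightarrow> g t \<ge> 0"
    and deriv: "\<And>t. t \<ge> 0 \<Longrightarrow> (F has_real_derivative 1 / h * exp (- t / h) * g t) (at t)"
    and lim: "(F \<longlongrightarrow> 0) at_top"
  shows "(\<integral>\<^sup>+ t. ennreal (g t) \<partial>waiting_time h) = ennreal (- F 0)"
proof -
  have "(\<integral>\<^sup>+ t. ennreal (g t) \<partial>waiting_time h) =
      (\<integral>\<^sup>+ t. ennreal (1 / h * exp (- t / h) * g t) * indicator {0..} t \<partial>lborel)"
  proof (subst nn_integral_waiting_time, measurable, rule nn_integral_cong)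
    fix t
    have "ennreal (1 / h * exp (- t / h) * g t) = ennreal (1 / h * exp (- t / h)) * ennreal (g t)"
      using h by (intro ennreal_mult') simp
    then show "ennreal (1 / h * exp (- t / h)) * ennreal (g t) * indicator {0..} t =
        ennreal (1 / h * exp (- t / h) * g t) * indicator {0..} t"
      by simp
  qed
  also have "\<dots> = ennreal (0 - F 0)"
  proof (rule nn_integral_FTC_atLeast[OF _ deriv _ lim])
    show "0 \<le> 1 / h * exp (- t / h) * g t" if "0 \<le> t" for t
      using h nonneg[OF that] by simp
  qed measurable
  finally show ?thesis by simp
qed

lemma exp_decay_tendsto_0: "h > 0 \<Longrightarrow> ((\<lambda>t::real. exp (- t / h)) \<longlongrightarrow> 0) at_top"
  by (intro filterlim_compose[OF exp_at_bot])
     (auto simp: filterlim_uminus_at_bot intro!: filterlim_tendsto_pos_mult_at_top[OF tendsto_const _ filterlim_ident, of "1/h", simplified])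

lemma mean_waiting_time:
  assumes "h > 0"
  shows "(\<integral>\<^sup>+ t. ennreal (a * t) \<partial>waiting_time h) = ennreal (a * h)"
proof (cases "a \<ge> 0")
  case True
  have "(\<integral>\<^sup>+ t. ennreal t \<partial>waiting_time h) =
      (\<integral>\<^sup>+ t. ennreal (exponential_density (1 / h) t * t ^ 1) \<partial>lborel)"
    unfolding waiting_time_def using assms
    by (subst nn_integral_density) (auto simp: exponential_density_def ennreal_mult' intro!: nn_integral_cong)
  also have "\<dots> = ennreal h"
    using assms by (subst nn_integral_erlang_ith_moment) auto
  finally show ?thesis using True assms
    by (simp add: ennreal_mult' nn_integral_cmult)
next
  case False
  have "(\<integral>\<^sup>+ t. ennreal (a * t) \<partial>waiting_time h) \<le> (\<integral>\<^sup>+ t. 0 \<partial>waiting_time h)"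
    using False by (intro nn_integral_waiting_time_mono) (auto simp: ennreal_neg mult_nonpos_nonneg)
  then show ?thesis using False assms by (simp add: ennreal_neg mult_nonpos_nonneg)
qed

lemma laplace_waiting_time:
  assumes h: "h > 0"
  shows "(\<integral>\<^sup>+ t. ennreal (exp (- 2 * t)) \<partial>waiting_time h) = ennreal (1 / (1 + 2 * h))"
proof -
  define F where "F t = - 1 / (1 + 2 * h) * (exp (- t / h) * exp (- 2 * t))" for t
  have "((\<lambda>t. - 1 / (1 + 2 * h) * (exp (- t / h) * exp (- t / (1/2)))) \<longlongrightarrow> - 1 / (1 + 2 * h) * (0 * 0)) at_top"
    by (intro tendsto_mult exp_decay_tendsto_0 tendsto_const h) auto
  then have "(F \<longlongrightarrow> 0) at_top" unfolding F_def by (simp add: mult.commute)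
  moreover have "(F has_real_derivative 1 / h * exp (- t / h) * exp (- 2 * t)) (at t)" for t
  proof -
    have "(F has_real_derivative - 1 / (1 + 2 * h) *
        (exp (- t / h) * (- 1 / h) * exp (- 2 * t) + exp (- t / h) * (exp (- 2 * t) * - 2))) (at t)"
      unfolding F_def using h by (auto intro!: derivative_eq_intros)
    also have "- 1 / (1 + 2 * h) *
        (exp (- t / h) * (- 1 / h) * exp (- 2 * t) + exp (- t / h) * (exp (- 2 * t) * - 2)) =
        (1 / (1 + 2 * h) * (1 / h + 2)) * (exp (- t / h) * exp (- 2 * t))"
      by (simp only: ring_distribs) simp
    also have "1 / (1 + 2 * h) * (1 / h + 2) = 1 / h"
      using h by (simp add: divide_simps)
    finally show ?thesis by simp
  qed
  ultimately have "(\<integral>\<^sup>+ t. ennreal (exp (- 2 * t)) \<partial>waiting_time h) = ennreal (- F 0)"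
    by (intro nn_integral_waiting_time_FTC[OF h]) auto
  then show ?thesis by (simp add: F_def)
qed

text \<open>
  The square is a constant plus multiples of \<open>cos (2 a t)\<close> and \<open>sin (2 a t)\<close>, and damped trigonometric
  functions have antiderivatives of the same kind. The point of the closed form is that it is a
  sum of two nonnegative terms: the first one, \<open>v\<^sup>2 / 2\<close>, does not depend on the angular speed \<open>a\<close>, and
  the second one vanishes only for \<open>v = s u\<close>; so the mean is large if \<open>v\<close> or \<open>s u\<close> is, apart from the
  factor \<open>1 + s\<^sup>2\<close>.
\<close>

lemma second_moment_random_rotation:
  fixes a h r u v :: real
  assumes h: "h > 0" and r: "r \<ge> 0"
  defines "s \<equiv> 2 * a * h"
  shows "(\<integral>\<^sup>+ t. ennreal (r * (v * cos (a * t) - u * sin (a * t))\<^sup>2) \<partial>waiting_time h) =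
    ennreal (r * (v\<^sup>2 + (v - s * u)\<^sup>2 / (1 + s\<^sup>2)) / 2)"
proof -
  define A B D where "A = (u\<^sup>2 + v\<^sup>2) / 2" and "B = (v\<^sup>2 - u\<^sup>2) / 2" and "D = - (u * v)"
  \<comment> \<open>\<open>P\<close> and \<open>Q\<close> solve the linear equations \<open>PQ\<close> below, which express that \<open>F\<close> is an antiderivative.\<close>
  define P Q where "P = - (B + s * D) / (1 + s\<^sup>2)" and "Q = (s * B - D) / (1 + s\<^sup>2)"
  define F where "F t = r * (exp (- t / h) * (P * cos (2 * a * t) + Q * sin (2 * a * t) - A))" for t
  have s1: "1 + s\<^sup>2 \<noteq> 0" using zero_le_power2[of s] by linarith
  have P: "P * (1 + s\<^sup>2) = - (B + s * D)" and Q: "Q * (1 + s\<^sup>2) = s * B - D"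
    using s1 by (simp_all add: P_def Q_def)
  have "(s * Q - P) * (1 + s\<^sup>2) = s * (Q * (1 + s\<^sup>2)) - P * (1 + s\<^sup>2)"
    by (simp only: left_diff_distrib mult.assoc)
  also have "\<dots> = B * (1 + s\<^sup>2)"
    unfolding P Q by (simp add: algebra_simps power2_eq_square)
  finally have PQ1: "(s * Q - P) * (1 + s\<^sup>2) = B * (1 + s\<^sup>2)" .
  have "(- s * P - Q) * (1 + s\<^sup>2) = - s * (P * (1 + s\<^sup>2)) - Q * (1 + s\<^sup>2)"
    by (simp only: left_diff_distrib mult.assoc)
  also have "\<dots> = D * (1 + s\<^sup>2)"
    unfolding P Q by (simp add: algebra_simps power2_eq_square)
  finally have PQ2: "(- s * P - Q) * (1 + s\<^sup>2) = D * (1 + s\<^sup>2)" .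
  have PQ: "s * Q - P = B" "- s * P - Q = D"
    using PQ1 PQ2 s1 unfolding mult_cancel_right by simp_all
  have trig: "(v * cos \<theta> - u * sin \<theta>)\<^sup>2 = A + B * cos (2 * \<theta>) + D * sin (2 * \<theta>)" for \<theta>
  proof -
    have "(v * c - u * s')\<^sup>2 = (u\<^sup>2 + v\<^sup>2) * (s'\<^sup>2 + c\<^sup>2) / 2 +
        (v\<^sup>2 - u\<^sup>2) / 2 * (c\<^sup>2 - s'\<^sup>2) - u * v * (2 * s' * c)" for c s' :: real
      by (simp add: power2_eq_square field_simps)
    from this[of "cos \<theta>" "sin \<theta>"]  show ?thesis
      unfolding A_def B_def D_def cos_double sin_double sin_cos_squared_add by simp
  qed
  have "(\<integral>\<^sup>+ t. ennreal (r * (v * cos (a * t) - u * sin (a * t))\<^sup>2) \<partial>waiting_time h) = ennreal (- F 0)"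
  proof (rule nn_integral_waiting_time_FTC[OF h])
    show "(F has_real_derivative 1 / h * exp (- t / h) * (r * (v * cos (a * t) - u * sin (a * t))\<^sup>2)) (at t)" for t
    proof -
      have E: "r * (E * (- 1 / h) * (P * x + Q * y - A) + (P * (- y * (2 * a)) + Q * (x * (2 * a)) - 0) * E) =
          1 / h * E * (r * (A + (s * Q - P) * x + (- s * P - Q) * y))" for E x y
        using h by (simp add: s_def field_simps)
      have d: "((\<lambda>t. exp (- t / h)) has_real_derivative exp (- t / h) * (- 1 / h)) (at t)"
        "((\<lambda>t. cos (2 * a * t)) has_real_derivative - sin (2 * a * t) * (2 * a)) (at t)"
        "((\<lambda>t. sin (2 * a * t)) has_real_derivative cos (2 * a * t) * (2 * a)) (at t)"
        using h by (auto intro!: derivative_eq_intros)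
      have "(F has_real_derivative r * (exp (- t / h) * (- 1 / h) * (P * cos (2 * a * t) + Q * sin (2 * a * t) - A)
          + (P * (- sin (2 * a * t) * (2 * a)) + Q * (cos (2 * a * t) * (2 * a)) - 0) * exp (- t / h))) (at t)"
        unfolding F_def by (intro DERIV_cmult DERIV_mult DERIV_diff DERIV_add d DERIV_const)
      then have "(F has_real_derivative 1 / h * exp (- t / h) * (r * (A + (s * Q - P) * cos (2 * (a * t))
          + (- s * P - Q) * sin (2 * (a * t))))) (at t)"
        unfolding E by (simp only: mult.assoc)
      then show ?thesis unfolding PQ trig .
    qed
    have "((\<lambda>t. exp (- t / h) * (P * cos (2 * a * t) + Q * sin (2 * a * t) - A)) \<longlongrightarrow> 0) at_top"
    proof (rule Lim_null_comparison)
      show "\<forall>\<^sub>F t in at_top. norm (exp (- t / h) * (P * cos (2 * a * t) + Q * sin (2 * a * t) - A)) \<le>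
          exp (- t / h) * (\<bar>P\<bar> + \<bar>Q\<bar> + \<bar>A\<bar>)"
      proof (intro always_eventually allI)
        fix t
        have "\<bar>P * cos (2 * a * t)\<bar> \<le> \<bar>P\<bar> * 1" "\<bar>Q * sin (2 * a * t)\<bar> \<le> \<bar>Q\<bar> * 1"
          unfolding abs_mult by (intro mult_left_mono; simp)+
        then have "\<bar>P * cos (2 * a * t) + Q * sin (2 * a * t) - A\<bar> \<le> \<bar>P\<bar> + \<bar>Q\<bar> + \<bar>A\<bar>"
          by linarith
        then show "norm (exp (- t / h) * (P * cos (2 * a * t) + Q * sin (2 * a * t) - A)) \<le>
          exp (- t / h) * (\<bar>P\<bar> + \<bar>Q\<bar> + \<bar>A\<bar>)"
          by (simp add: abs_mult)
      qed
      show "((\<lambda>t. exp (- t / h) * (\<bar>P\<bar> + \<bar>Q\<bar> + \<bar>A\<bar>)) \<longlongrightarrow> 0) at_top"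
        by (rule tendsto_mult_left_zero) (rule exp_decay_tendsto_0[OF h])
    qed
    then show "(F \<longlongrightarrow> 0) at_top"
      unfolding F_def by (rule tendsto_mult_right_zero)
  qed (use r in auto)
  also have "- F 0 = r * (A - P)" by (simp add: F_def algebra_simps)
  also have "A - P = (v\<^sup>2 + (v - s * u)\<^sup>2 / (1 + s\<^sup>2)) / 2"
  proof -
    have "(A - P) * (1 + s\<^sup>2) = A * (1 + s\<^sup>2) - P * (1 + s\<^sup>2)"
      by (rule left_diff_distrib)
    also have "\<dots> = (v\<^sup>2 * (1 + s\<^sup>2) + (v - s * u)\<^sup>2) / 2"
      unfolding P by (simp add: A_def B_def D_def power2_eq_square algebra_simps add_divide_distrib diff_divide_distrib)
    also have "\<dots> = (v\<^sup>2 + (v - s * u)\<^sup>2 / (1 + s\<^sup>2)) / 2 * (1 + s\<^sup>2)"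
      using s1 by (simp add: distrib_right)
    finally show ?thesis using s1 by simp
  qed
  finally show ?thesis by simp
qed

text \<open>
  If a nonnegative function cannot be small at both times \<open>t\<close> and \<open>t + 1\<close>, then its mean over an
  exponential time is not small: the exponential law conditioned to exceed \<open>1\<close> is the law shifted by
  \<open>1\<close>, so the mean of \<open>g (t + 1)\<close> is at most \<open>exp (1 / h)\<close> times the mean of \<open>g\<close>.
\<close>

lemma nn_integral_waiting_time_ge_half:
  fixes g :: "real \<Rightarrow> real"
  assumes h: "h > 0" and g [measurable]: "g \<in> borel_measurable borel"
    and nonneg: "\<And>t. g t \<ge> 0"
    and c: "\<And>t. t \<ge> 0 \<Longrightarrow> c \<le> g t + g (t + 1)"
  shows "ennreal (c / (1 + exp (1 / h))) \<le> (\<integral>\<^sup>+ t. ennreal (g t) \<partial>waiting_time h)"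
proof -
  interpret prob_space "waiting_time h" by (rule prob_space_waiting_time[OF h])
  let ?I = "\<integral>\<^sup>+ t. ennreal (g t) \<partial>waiting_time h"
  have "(\<integral>\<^sup>+ t. ennreal (g (t + 1)) \<partial>waiting_time h) =
      (\<integral>\<^sup>+ t. ennreal (exp (1 / h)) * (ennreal (1 / h * exp (- (1 + 1 * t) / h)) * ennreal (g (1 + 1 * t)) * indicator {1..} (1 + 1 * t)) \<partial>lborel)"
    by (subst nn_integral_waiting_time)
       (auto simp: indicator_def mult.assoc[symmetric] ennreal_mult'[symmetric] exp_add[symmetric]
         add_divide_distrib diff_divide_distrib add.commute intro!: nn_integral_cong)
  also have "\<dots> = (\<integral>\<^sup>+ t. ennreal (exp (1 / h)) * (ennreal (1 / h * exp (- t / h)) * ennreal (g t) * indicator {1..} t) \<partial>lborel)"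
    by (subst nn_integral_real_affine[where c = 1 and t = 1]) auto
  also have "\<dots> \<le> (\<integral>\<^sup>+ t. ennreal (exp (1 / h)) * (ennreal (1 / h * exp (- t / h)) * ennreal (g t) * indicator {0..} t) \<partial>lborel)"
    by (intro nn_integral_mono mult_left_mono) (auto simp: indicator_def)
  also have "\<dots> = ennreal (exp (1 / h)) * ?I"
    by (subst nn_integral_cmult) (auto simp: nn_integral_waiting_time)
  finally have shift: "(\<integral>\<^sup>+ t. ennreal (g (t + 1)) \<partial>waiting_time h) \<le> ennreal (exp (1 / h)) * ?I" .
  have "ennreal c = (\<integral>\<^sup>+ t. ennreal c \<partial>waiting_time h)"
    by (simp add: emeasure_space_1[simplified])
  also have "\<dots> \<le> (\<integral>\<^sup>+ t. ennreal (g t + g (t + 1)) \<partial>waiting_time h)"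
    using c by (intro nn_integral_waiting_time_mono) (auto intro!: ennreal_leI)
  also have "\<dots> = ?I + (\<integral>\<^sup>+ t. ennreal (g (t + 1)) \<partial>waiting_time h)"
    using nonneg by (simp add: nn_integral_add)
  also have "\<dots> \<le> ?I + ennreal (exp (1 / h)) * ?I"
    by (intro add_left_mono shift)
  also have "\<dots> = ennreal (1 + exp (1 / h)) * ?I"
    by (simp add: ring_distribs)
  finally have "inverse (ennreal (1 + exp (1 / h))) * ennreal c \<le> inverse (ennreal (1 + exp (1 / h))) * (ennreal (1 + exp (1 / h)) * ?I)"
    by (intro mult_left_mono) auto
  moreover have e: "1 + exp (1 / h) > 0" by (smt (verit) exp_gt_zero)
  have "inverse (ennreal (1 + exp (1 / h))) * ennreal c = ennreal (c / (1 + exp (1 / h)))"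
    using e by (simp add: inverse_ennreal ennreal_mult''[symmetric] divide_inverse mult.commute[of _ "ennreal c"] del: ennreal_plus)
  moreover have "inverse (ennreal (1 + exp (1 / h))) * (ennreal (1 + exp (1 / h)) * ?I) = ?I"
    using e by (simp add: inverse_ennreal mult.assoc[symmetric] ennreal_mult'[symmetric] del: ennreal_plus)
  ultimately show ?thesis by simp
qed

section \<open>The norm and the shares of the coordinates\<close>

text \<open>Coordinates are indexed from \<open>1\<close>; keeping this literal as it is lets rules about the index set
  \<open>{1..d}\<close> apply to simplified goals.\<close>

declare One_nat_def [simp del]

abbreviation state :: "nat \<Rightarrow> (nat \<Rightarrow> real) measure" where
  "state d \<equiv> Pi\<^sub>M {1..d} (\<lambda>_. borel)"

lemma space_state [simp]: "space (state d) = Rd d"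
  by (simp add: space_PiM Rd_def)

text \<open>
  Dividing by the norm, and not by its square, makes the shares add up to the norm, keeps
  them invariant under the rotations of the other coordinates, and makes them Lipschitz, so that
  bounded translations cost bounded errors. At the origin the quotient is \<open>0\<close>.
\<close>

definition share :: "nat \<Rightarrow> nat \<Rightarrow> (nat \<Rightarrow> real) \<Rightarrow> real" where
  "share d j x = (x j)\<^sup>2 / Rd_norm d x"

lemma Rd_norm_nonneg [simp]: "Rd_norm d x \<ge> 0"
  by (simp add: Rd_norm_def)

lemma share_nonneg [simp]: "share d j x \<ge> 0"
  by (simp add: share_def)

lemma Rd_norm_sq: "(Rd_norm d x)\<^sup>2 = (\<Sum>j=1..d. (x j)\<^sup>2)"
  by (simp add: Rd_norm_def L2_set_def sum_nonneg)

lemma Rd_norm_cong: "(\<And>j. j \<in> {1..d} \<Longrightarrow> x j = y j) \<Longrightarrow> Rd_norm d x = Rd_norm d y"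
  unfolding Rd_norm_def by (rule L2_set_cong) auto

lemma Rd_norm_mono:
  assumes "\<And>j. j \<in> {1..d} \<Longrightarrow> \<bar>x j\<bar> \<le> \<bar>y j\<bar>"
  shows "Rd_norm d x \<le> Rd_norm d y"
  unfolding Rd_norm_def L2_set_def using assms
  by (intro real_sqrt_le_mono sum_mono) (simp add: abs_le_square_iff)

lemma Rd_norm_triangle: "Rd_norm d (\<lambda>j. x j + y j) \<le> Rd_norm d x + Rd_norm d y"
  unfolding Rd_norm_def by (rule L2_set_triangle_ineq)

lemma abs_le_Rd_norm: "j \<in> {1..d} \<Longrightarrow> \<bar>x j\<bar> \<le> Rd_norm d x"
  unfolding Rd_norm_def L2_set_def
  by (rule real_le_rsqrt) (auto intro!: member_le_sum)

lemma sq_le_Rd_norm_sq: "j \<in> {1..d} \<Longrightarrow> (x j)\<^sup>2 \<le> (Rd_norm d x)\<^sup>2"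
  using abs_le_Rd_norm[of j d x] by (simp add: abs_le_square_iff[symmetric])

lemma sum_share: "(\<Sum>j=1..d. share d j x) = Rd_norm d x"
  by (simp add: share_def sum_divide_distrib[symmetric] Rd_norm_sq[symmetric, simplified])
     (simp add: power2_eq_square)

text \<open>
  The gradient \<open>2 x\<^sub>j / |x| e\<^sub>j - x\<^sub>j\<^sup>2 / |x|\<^sup>3 x\<close> of the share has norm at most \<open>3\<close>. The direct
  computation below avoids a segment that may pass through the origin.
\<close>

lemma share_perturb:
  assumes j: "j \<in> {1..d}"
  shows "share d j x \<le> share d j (\<lambda>i. x i + y i) + 3 * Rd_norm d y"
proof -
  define A B r where "A = Rd_norm d x" and "B = Rd_norm d (\<lambda>i. x i + y i)" and "r = Rd_norm d y"
  have nn: "A \<ge> 0" "B \<ge> 0" "r \<ge> 0" by (simp_all add: A_def B_def r_def)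
  have bounds: "\<bar>x j\<bar> \<le> A" "\<bar>y j\<bar> \<le> r" "\<bar>x j + y j\<bar> \<le> B"
    using abs_le_Rd_norm[OF j] by (simp_all add: A_def B_def r_def)
  have BA: "B \<le> A + r" unfolding A_def B_def r_def by (rule Rd_norm_triangle)
  have AB: "A \<le> B + r"
  proof -
    have "A \<le> B + Rd_norm d (\<lambda>i. - y i)"
      using Rd_norm_triangle[of d "\<lambda>i. x i + y i" "\<lambda>i. - y i"] by (simp add: A_def B_def)
    then show ?thesis by (simp add: r_def Rd_norm_def L2_set_def)
  qed
  consider "A = 0" | "A > 0" "B = 0" | "A > 0" "B > 0" using nn by linarith
  then have "(x j)\<^sup>2 / A \<le> (x j + y j)\<^sup>2 / B + 3 * r"
  proof cases
    case 1
    then show ?thesis using nn by simp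
  next
    case 2
    have "(x j)\<^sup>2 \<le> A\<^sup>2" using bounds(1) nn(1) by (simp add: abs_le_square_iff[symmetric])
    then have "(x j)\<^sup>2 / A \<le> A" using 2 by (simp add: divide_simps power2_eq_square)
    then show ?thesis using AB 2 nn by simp
  next
    case 3
    have xy: "- (x j * y j) \<le> A * r"
    proof -
      have "\<bar>x j * y j\<bar> \<le> A * r" unfolding abs_mult using bounds nn by (intro mult_mono) auto
      then show ?thesis by linarith
    qed
    have x2: "(x j)\<^sup>2 \<le> A * A" using bounds(1) nn(1) by (simp add: abs_le_square_iff[symmetric] power2_eq_square[symmetric])
    have "((x j)\<^sup>2 / A - 3 * r) * (A + r) = (x j)\<^sup>2 + r * ((x j)\<^sup>2 / A) - 3 * (r * A) - 3 * (r * r)"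
      using 3 by (simp add: field_simps)
    also have "\<dots> \<le> (x j)\<^sup>2 + r * A - 3 * (r * A) - 0"
      using x2 3 nn by (intro diff_mono add_mono mult_left_mono) (auto simp: divide_simps)
    also have "\<dots> \<le> (x j + y j)\<^sup>2"
    proof -
      have "- (2 * (A * r)) \<le> (y j)\<^sup>2 + 2 * (x j * y j)"
        using xy zero_le_power2[of "y j"] by linarith
      then show ?thesis unfolding power2_sum mult.assoc by (simp add: mult.commute[of r A])
    qed
    finally have "(x j)\<^sup>2 / A - 3 * r \<le> (x j + y j)\<^sup>2 / (A + r)"
      using 3 nn by (simp add: pos_le_divide_eq)
    also have "\<dots> \<le> (x j + y j)\<^sup>2 / B"
      using BA 3 by (intro divide_left_mono) auto
    finally show ?thesis by simp
  qed
  then show ?thesis by (simp add: share_def A_def B_def r_def)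
qed

lemma measurable_Rd_norm [measurable]: "Rd_norm d \<in> borel_measurable (state d)"
  unfolding Rd_norm_def L2_set_def by measurable

lemma measurable_share [measurable]: "j \<in> {1..d} \<Longrightarrow> share d j \<in> borel_measurable (state d)"
  unfolding share_def by measurable

section \<open>Explicit flows of the split fields\<close>

definition rotation :: "nat \<Rightarrow> nat \<Rightarrow> real \<Rightarrow> (nat \<Rightarrow> real) \<Rightarrow> nat \<Rightarrow> real" where
  "rotation d i t x = (let n = cyc d (i + 1); \<theta> = x (cyc d (i - 1)) * t in
     (\<lambda>j\<in>{1..d}. if j = i then x i * cos \<theta> + x n * sin \<theta>
       else if j = n then x n * cos \<theta> - x i * sin \<theta> else x j))"

definition drift :: "nat \<Rightarrow> (nat \<Rightarrow> real) \<Rightarrow> real \<Rightarrow> (nat \<Rightarrow> real) \<Rightarrow> nat \<Rightarrow> real" where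
  "drift d \<beta> t x = (\<lambda>j\<in>{1..d}. if j = 1 then \<beta> 1 + (x 1 - \<beta> 1) * exp (- t) else x j + \<beta> j * t)"

text \<open>
  An explicit version of the flows, extended by the identity to labels of no field. This makes it
  jointly measurable in time and space for every label, whereas the description of a flow by its
  integral curve says nothing if the field is not one of those of the splitting.
\<close>

fun split_flow :: "nat \<Rightarrow> (nat \<Rightarrow> real) \<Rightarrow> field_label \<Rightarrow> real \<Rightarrow> (nat \<Rightarrow> real) \<Rightarrow> nat \<Rightarrow> real" where
  "split_flow d \<beta> (Coord i) t x = (if i \<in> {1..d} then rotation d i t x else x)"
| "split_flow d \<beta> Star t x = drift d \<beta> t x"

lemma cyc_neighbours:
  assumes "d \<ge> 3" "i \<in> {1..d}"
  shows "cyc d (i + 1) \<in> {1..d}" "cyc d (i - 1) \<in> {1..d}"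
    "cyc d (i + 1) \<noteq> i" "cyc d (i - 1) \<noteq> i" "cyc d (i - 1) \<noteq> cyc d (i + 1)"
  using assms cyc_simps[of d i] cyc_in[of d "i + 1"] cyc_in[of d "i - 1"] by (auto split: if_splits)

lemma split_flow_in_Rd: "x \<in> Rd d \<Longrightarrow> split_flow d \<beta> l t x \<in> Rd d"
  by (cases l) (auto simp: Rd_def rotation_def drift_def Let_def)

lemma flow_eq_split_flow:
  assumes d: "d \<ge> 4" and l: "l \<in> labels d" and x: "x \<in> Rd d"
  shows "flow d (split_field d \<beta> l) t x = split_flow d \<beta> l t x"
proof -
  have "integral_curve d (split_field d \<beta> l) x (\<lambda>t. split_flow d \<beta> l t x)"
    unfolding integral_curve_def
  proof (intro conjI allI ballI split_flow_in_Rd x)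
    show "split_flow d \<beta> l 0 x = x"
      using x by (cases l) (auto simp: rotation_def drift_def Let_def Rd_def fun_eq_iff PiE_def extensional_def)
    fix t j assume j: "j \<in> {1..d}"
    show "((\<lambda>s. split_flow d \<beta> l s x j) has_real_derivative split_field d \<beta> l (split_flow d \<beta> l t x) j) (at t)"
    proof (cases l)
      case (Coord i)
      with l have i: "i \<in> {1..d}" by (auto simp: labels_def)
      have np: "cyc d (i + 1) \<in> {1..d}" "cyc d (i - 1) \<in> {1..d}"
        "cyc d (i + 1) \<noteq> i" "cyc d (i - 1) \<noteq> i" "cyc d (i - 1) \<noteq> cyc d (i + 1)"
        using cyc_neighbours[of d i] d i by auto
      define n p where "n = cyc d (i + 1)" and "p = cyc d (i - 1)"
      note np = np[folded n_def p_def]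
      consider "j = i" | "j = n" | "j \<noteq> i" "j \<noteq> n" by blast
      then show ?thesis
        unfolding Coord split_field.simps split_flow.simps rotation_def Let_def n_def[symmetric] p_def[symmetric]
        by cases (use i j np in \<open>auto simp: basis_vec_def algebra_simps intro!: derivative_eq_intros\<close>)
    next
      case Star
      have "(\<Sum>i=1..d. \<beta> i * basis_vec i j) = (\<Sum>i=1..d. if i = j then \<beta> i else 0)"
        by (intro sum.cong) (auto simp: basis_vec_def)
      then have "(\<Sum>i=1..d. \<beta> i * basis_vec i j) = \<beta> j" using j by simp
      then show ?thesis
        unfolding Star using j d
        by (cases "j = 1") (auto simp: drift_def basis_vec_def intro!: derivative_eq_intros)
    qed
  qed
  then show ?thesis
    unfolding flow_def using the1_equality[OF ex1_integral_curve[OF d l x]] by metis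
qed

lemma measurable_split_flow [measurable]:
  assumes d: "d \<ge> 4"
  shows "(\<lambda>(t, x). split_flow d \<beta> l t x) \<in> borel \<Otimes>\<^sub>M state d \<rightarrow>\<^sub>M state d"
proof (cases l)
  case Star
  have "1 \<in> {1..d}" using d by simp
  then show ?thesis unfolding Star split_flow.simps drift_def split_beta
    by (intro measurable_restrict) measurable
next
  case (Coord i)
  show ?thesis
  proof (cases "i \<in> {1..d}")
    case True
    have [measurable]: "cyc d (i + 1) \<in> {1..d}" "cyc d (i - 1) \<in> {1..d}" "i \<in> {1..d}"
      using cyc_neighbours[of d i] d True by auto
    show ?thesis using True unfolding Coord split_flow.simps rotation_def Let_def split_beta if_P[OF True]
      by (intro measurable_restrict) measurable
  next
    case False
    show ?thesis unfolding Coord split_flow.simps if_not_P[OF False] by measurable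
  qed
qed

lemma Rd_norm_rotation:
  assumes d: "d \<ge> 3" and i: "i \<in> {1..d}"
  shows "Rd_norm d (rotation d i t x) = Rd_norm d x"
proof -
  define n \<theta> where "n = cyc d (i + 1)" and "\<theta> = x (cyc d (i - 1)) * t"
  note n = cyc_neighbours(1,3)[OF d i, folded n_def]
  let ?y = "rotation d i t x"
  have y: "?y i = x i * cos \<theta> + x n * sin \<theta>" "?y n = x n * cos \<theta> - x i * sin \<theta>"
    "\<And>j. j \<in> {1..d} - {i, n} \<Longrightarrow> ?y j = x j"
    using i n unfolding rotation_def Let_def n_def[symmetric] \<theta>_def[symmetric] by auto
  have split: "(\<Sum>j=1..d. (f j)\<^sup>2) = (f i)\<^sup>2 + (f n)\<^sup>2 + (\<Sum>j\<in>{1..d} - {i, n}. (f j)\<^sup>2)" for f :: "nat \<Rightarrow> real"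
  proof -
    have "{1..d} = insert i (insert n ({1..d} - {i, n}))" using i n by auto
    then have "(\<Sum>j=1..d. (f j)\<^sup>2) = (\<Sum>j\<in>insert i (insert n ({1..d} - {i, n})). (f j)\<^sup>2)" by simp
    also have "\<dots> = (f i)\<^sup>2 + (f n)\<^sup>2 + (\<Sum>j\<in>{1..d} - {i, n}. (f j)\<^sup>2)"
      using n by (subst sum.insert; simp)+
    finally show ?thesis .
  qed
  have "(a * c + b * s)\<^sup>2 + (b * c - a * s)\<^sup>2 = (a\<^sup>2 + b\<^sup>2) * (s\<^sup>2 + c\<^sup>2)" for a b c s :: real
    by (simp add: power2_eq_square algebra_simps)
  from this[of "x i" "cos \<theta>" "x n" "sin \<theta>"]
  have "(?y i)\<^sup>2 + (?y n)\<^sup>2 = (x i)\<^sup>2 + (x n)\<^sup>2" unfolding y by simp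
  then have "(\<Sum>j=1..d. (?y j)\<^sup>2) = (\<Sum>j=1..d. (x j)\<^sup>2)"
    unfolding split using y(3) by simp
  then show ?thesis by (simp add: Rd_norm_def L2_set_def)
qed

text \<open>
  Isolates the damping, a linear map that does not increase the norm, from a translation whose size does
  not depend on the starting point.
\<close>

lemma drift_decompose:
  fixes \<beta> :: "nat \<Rightarrow> real"
  assumes d: "d \<ge> 1" and t: "t \<ge> 0"
  obtains y v where "\<And>j. j \<in> {1..d} \<Longrightarrow> drift d \<beta> t x j = y j + v j"
    "\<And>j. y j = (if j = 1 then exp (- t) * x 1 else x j)" "Rd_norm d v \<le> Rd_norm d \<beta> * t"
proof
  let ?y = "\<lambda>j. if j = 1 then exp (- t) * x 1 else x j"
  let ?v = "\<lambda>j. if j = 1 then \<beta> 1 * (1 - exp (- t)) else \<beta> j * t"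
  show "drift d \<beta> t x j = ?y j + ?v j" if "j \<in> {1..d}" for j
    using that by (auto simp: drift_def algebra_simps)
  have "Rd_norm d ?v \<le> Rd_norm d (\<lambda>j. \<beta> j * t)"
  proof (rule Rd_norm_mono)
    fix j
    have "0 \<le> 1 - exp (- t)" "1 - exp (- t) \<le> t" using t exp_ge_add_one_self[of "- t"] by auto
    then show "\<bar>?v j\<bar> \<le> \<bar>\<beta> j * t\<bar>" using t by (auto simp: abs_mult intro!: mult_left_mono)
  qed
  also have "\<dots> = Rd_norm d \<beta> * t"
    unfolding Rd_norm_def by (rule L2_set_left_distrib[OF t, symmetric])
  finally show "Rd_norm d ?v \<le> Rd_norm d \<beta> * t" .
qed simp

text \<open>
  Damping lowers \<open>|x|\<^sup>2\<close> by \<open>q = (1 - exp (- 2 t)) x\<^sub>1\<^sup>2\<close>, hence \<open>|x|\<close> by at least \<open>q / (2 |x|)\<close>, since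
  \<open>sqrt (N\<^sup>2 - q) \<le> N - q / (2 N)\<close>.
\<close>

lemma Rd_norm_drift:
  assumes d: "d \<ge> 1" and t: "t \<ge> 0"
  shows "Rd_norm d (drift d \<beta> t x) + (1 - exp (- 2 * t)) / 2 * share d 1 x \<le> Rd_norm d x + Rd_norm d \<beta> * t"
proof -
  obtain y v where dec: "\<And>j. j \<in> {1..d} \<Longrightarrow> drift d \<beta> t x j = y j + v j"
    and y: "\<And>j. y j = (if j = 1 then exp (- t) * x 1 else x j)" and v: "Rd_norm d v \<le> Rd_norm d \<beta> * t"
    using drift_decompose[OF d t, of \<beta> x] by metis
  define N q where "N = Rd_norm d x" and "q = (1 - exp (- 2 * t)) * (x 1)\<^sup>2"
  have d1: "1 \<in> {1..d}" using d by simp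
  have e: "exp (- 2 * t) = (exp (- t))\<^sup>2" by (simp add: power2_eq_square flip: exp_add)
  have q: "0 \<le> q" "q \<le> N\<^sup>2"
  proof -
    have "q \<le> 1 * (x 1)\<^sup>2" unfolding q_def by (intro mult_right_mono) auto
    also have "\<dots> \<le> N\<^sup>2" unfolding N_def using sq_le_Rd_norm_sq[OF d1] by simp
    finally show "q \<le> N\<^sup>2" .
    show "0 \<le> q" using t by (simp add: q_def)
  qed
  have "(Rd_norm d y)\<^sup>2 = N\<^sup>2 - q"
  proof -
    have s: "{1..d} = insert 1 {2..d}" using d by auto
    show ?thesis unfolding N_def q_def Rd_norm_sq s e
      by (simp add: y power_mult_distrib algebra_simps)
  qed
  have "Rd_norm d y \<le> N - q / (2 * N)"
  proof (cases "N = 0")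
    case True
    then show ?thesis using q \<open>(Rd_norm d y)\<^sup>2 = N\<^sup>2 - q\<close> by simp
  next
    case False
    then have N: "N > 0" using Rd_norm_nonneg[of d x] by (simp add: N_def less_le)
    have sq: "(Rd_norm d y)\<^sup>2 \<le> (N - q / (2 * N))\<^sup>2"
      unfolding \<open>(Rd_norm d y)\<^sup>2 = N\<^sup>2 - q\<close> power2_diff using N by simp
    have "q / (2 * N) \<le> N"
    proof -
      have "q \<le> N * (2 * N)"
        using q(2) mult_nonneg_nonneg[of N N] N unfolding power2_eq_square by linarith
      then show ?thesis using N by (subst pos_divide_le_eq) auto
    qed
    then show ?thesis using power2_le_imp_le[OF sq] by linarith
  qed
  moreover have "Rd_norm d (drift d \<beta> t x) \<le> Rd_norm d y + Rd_norm d v"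
    using Rd_norm_cong[of d "drift d \<beta> t x", OF dec] Rd_norm_triangle[of d y v] by simp
  moreover have "(1 - exp (- 2 * t)) / 2 * share d 1 x = q / (2 * N)"
    by (simp add: q_def N_def share_def)
  ultimately show ?thesis using v by (simp add: N_def)
qed

text \<open>
  Damping lowers no other share, as it can only decrease the norm in the denominator; the translation
  is controlled by the Lipschitz bound.
\<close>

lemma share_drift:
  assumes d: "d \<ge> 1" and t: "t \<ge> 0" and j: "j \<in> {1..d}"
  shows "(if j = 1 then exp (- 2 * t) else 1) * share d j x \<le> share d j (drift d \<beta> t x) + 3 * Rd_norm d \<beta> * t"
proof -
  obtain y v where dec: "\<And>j. j \<in> {1..d} \<Longrightarrow> drift d \<beta> t x j = y j + v j"
    and y: "\<And>j. y j = (if j = 1 then exp (- t) * x 1 else x j)" and v: "Rd_norm d v \<le> Rd_norm d \<beta> * t"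
    using drift_decompose[OF d t, of \<beta> x] by metis
  have e: "exp (- 2 * t) = (exp (- t))\<^sup>2" by (simp add: power2_eq_square flip: exp_add)
  have "Rd_norm d y \<le> Rd_norm d x"
    using t by (intro Rd_norm_mono) (auto simp: y abs_mult mult_left_le_one_le)
  moreover have "y j = 0" if "Rd_norm d y = 0"
    using abs_le_Rd_norm[OF j, of y] that by simp
  moreover have "Rd_norm d y > 0" if "Rd_norm d y \<noteq> 0"
    using that Rd_norm_nonneg[of d y] by linarith
  ultimately have "(y j)\<^sup>2 / Rd_norm d x \<le> share d j y"
    unfolding share_def by (cases "Rd_norm d y = 0") (auto intro!: divide_left_mono mult_pos_pos)
  also have "(y j)\<^sup>2 / Rd_norm d x = (if j = 1 then exp (- 2 * t) else 1) * share d j x"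
    unfolding e by (simp add: y share_def power_mult_distrib)
  also have "share d j y \<le> share d j (drift d \<beta> t x) + 3 * Rd_norm d v"
    using share_perturb[OF j, of y v] Rd_norm_cong[of d "drift d \<beta> t x", OF dec] dec[OF j]
    by (simp add: share_def)
  finally show ?thesis using v by simp
qed

text \<open>
  In one unit of time a coordinate \<open>p \<noteq> 1\<close> moves by \<open>\<beta>\<^sub>p\<close>, so it cannot be close to \<open>0\<close> at both ends.
  The first coordinate is pulled towards \<open>\<beta>\<^sub>1\<close>: its new value is a convex combination of the old one
  and \<open>\<beta>\<^sub>1\<close>, with weight \<open>1 - exp (- 1) \<ge> 1 / 2\<close> on \<open>\<beta>\<^sub>1\<close>.
\<close>

lemma drift_leaves_zero:
  assumes "p \<in> {1..d}"
  shows "\<bar>\<beta> p\<bar> / 2 \<le> \<bar>drift d \<beta> t x p\<bar> + \<bar>drift d \<beta> (t + 1) x p\<bar>"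
proof (cases "p = 1")
  case True
  define \<epsilon> a b where "\<epsilon> = exp (- 1 :: real)" and "a = drift d \<beta> t x p" and "b = drift d \<beta> (t + 1) x p"
  have \<epsilon>: "0 \<le> \<epsilon>" "\<epsilon> \<le> 1 / 2"
    using exp_ge_add_one_self[of 1] by (simp_all add: \<epsilon>_def exp_minus field_simps)
  have "b = \<epsilon> * a + (1 - \<epsilon>) * \<beta> p"
  proof -
    have "exp (- (t + 1)) = exp (- t) * \<epsilon>" unfolding \<epsilon>_def by (simp flip: exp_add)
    then have ab: "b = \<beta> 1 + (x 1 - \<beta> 1) * (exp (- t) * \<epsilon>)" "a = \<beta> 1 + (x 1 - \<beta> 1) * exp (- t)"
      using assms True by (simp_all add: a_def b_def drift_def del: One_nat_def)
    show ?thesis unfolding ab True by (simp add: algebra_simps)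
  qed
  then have "(1 - \<epsilon>) * \<bar>\<beta> p\<bar> \<le> \<epsilon> * \<bar>a\<bar> + \<bar>b\<bar>"
    using \<epsilon> abs_triangle_ineq4[of b "\<epsilon> * a"] by (simp add: abs_mult)
  moreover have "1 / 2 * \<bar>\<beta> p\<bar> \<le> (1 - \<epsilon>) * \<bar>\<beta> p\<bar>" "\<epsilon> * \<bar>a\<bar> \<le> 1 * \<bar>a\<bar>"
    by (intro mult_right_mono; use \<epsilon> in simp)+
  ultimately show ?thesis unfolding a_def b_def by linarith
next
  case False
  then have "drift d \<beta> (t + 1) x p = drift d \<beta> t x p + \<beta> p"
    using assms by (simp add: drift_def algebra_simps)
  then show ?thesis by linarith
qed

text \<open>
  A lower bound for the fraction of the share of \<open>i\<close> that the rotation \<open>i\<close> moves to \<open>i + 1\<close> on average,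
  where \<open>s\<close> is twice the mean angle of rotation.
\<close>

definition transfer_rate :: "real \<Rightarrow> real" where
  "transfer_rate s = s\<^sup>2 / (2 * (2 + s\<^sup>2))"

lemma transfer_rate_mono: "\<bar>s\<bar> \<le> \<bar>t\<bar> \<Longrightarrow> transfer_rate s \<le> transfer_rate t"
proof -
  have e: "transfer_rate s = 1 / 2 - 1 / (2 + s\<^sup>2)" for s
  proof -
    have "2 + s\<^sup>2 > 0" using zero_le_power2[of s] by linarith
    then show ?thesis by (simp add: transfer_rate_def field_simps)
  qed
  assume "\<bar>s\<bar> \<le> \<bar>t\<bar>"
  then have "s\<^sup>2 \<le> t\<^sup>2" by (simp add: abs_le_square_iff)
  moreover have "0 < 2 + s\<^sup>2" using zero_le_power2[of s] by linarith
  ultimately show ?thesis unfolding e by (intro diff_left_mono divide_left_mono) auto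
qed

lemma transfer_rate_bounds: "0 \<le> transfer_rate s" "transfer_rate s \<le> 1"
proof -
  have s: "0 \<le> s\<^sup>2" by simp
  have pos: "0 < 2 * (2 + s\<^sup>2)" by (intro mult_pos_pos add_pos_nonneg) auto
  then show "0 \<le> transfer_rate s"
    unfolding transfer_rate_def using s by (intro divide_nonneg_pos)
  show "transfer_rate s \<le> 1"
  proof -
    have "q \<le> 2 * (2 + q)" if "0 \<le> q" for q :: real using that by (simp add: distrib_left)
    from this[OF s] show ?thesis unfolding transfer_rate_def divide_le_eq_1_pos[OF pos] .
  qed
qed

lemma transfer_rate_pos: "s \<noteq> 0 \<Longrightarrow> 0 < transfer_rate s"
  unfolding transfer_rate_def by (intro divide_pos_pos) (auto intro!: add_pos_nonneg)

text \<open>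
  The rate is \<open>s\<^sup>2 / (2 (1 + S))\<close> with \<open>S = 1 + s\<^sup>2\<close>, which is the minimum of the right-hand side over \<open>v\<close>
  when \<open>u = 1\<close>; the difference of the two sides is a positive multiple of a complete square.
\<close>

lemma transfer_rate_le:
  "transfer_rate s * u\<^sup>2 \<le> (v\<^sup>2 + (v - s * u)\<^sup>2 / (1 + s\<^sup>2)) / 2"
proof -
  define S where "S = 1 + s\<^sup>2"
  have S: "S > 0" "2 + s\<^sup>2 = 1 + S" "s\<^sup>2 = S - 1" using zero_le_power2[of s] by (simp_all add: S_def add_pos_nonneg)
  have "(v\<^sup>2 + (v - s * u)\<^sup>2 / S) / 2 - s\<^sup>2 / (2 * (1 + S)) * u\<^sup>2
      = (v\<^sup>2 * S * (1 + S) + (v - s * u)\<^sup>2 * (1 + S) - s\<^sup>2 * u\<^sup>2 * S) / (2 * S * (1 + S))"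
    using S(1) by (simp add: divide_simps) (simp add: algebra_simps)
  also have "v\<^sup>2 * S * (1 + S) + (v - s * u)\<^sup>2 * (1 + S) - s\<^sup>2 * u\<^sup>2 * S = ((1 + S) * v - s * u)\<^sup>2"
    by (simp add: power2_eq_square algebra_simps)
  also have "((1 + S) * v - s * u)\<^sup>2 / (2 * S * (1 + S)) \<ge> 0" using S(1) by simp
  finally show ?thesis unfolding transfer_rate_def S_def[symmetric] S(2) by linarith
qed

lemma countable_field_label_lists: "countable (UNIV :: field_label list set)"
proof -
  have "(UNIV :: field_label set) = insert Star (range Coord)"
    by (auto intro: field_label.exhaust)
  then have "countable (UNIV :: field_label set)" by (metis countable_insert countable_image countableI_type)
  then show ?thesis using countable_lists[of "UNIV :: field_label set"] by simp
qed

section \<open>Averages over a single flow\<close>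

text \<open>
  In this locale \<open>K l\<close> averages over the flow of the field \<open>l\<close> at an exponential time, \<open>\<sigma> j\<close> is the
  share of \<open>j\<close>, and \<open>\<nu>\<close> is the norm.
\<close>

locale lorenz_splitting =
  fixes d :: nat and \<beta> :: "nat \<Rightarrow> real" and h :: real
  assumes d: "d \<ge> 4" and h: "h > 0" and \<beta>: "\<And>i. i \<in> {1..d} \<Longrightarrow> \<beta> i \<noteq> 0"
begin

abbreviation K :: "field_label \<Rightarrow> ((nat \<Rightarrow> real) \<Rightarrow> ennreal) \<Rightarrow> (nat \<Rightarrow> real) \<Rightarrow> ennreal" where
  "K l \<equiv> avg (waiting_time h) (split_flow d \<beta> l)"

abbreviation \<sigma> :: "nat \<Rightarrow> (nat \<Rightarrow> real) \<Rightarrow> ennreal" where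
  "\<sigma> j x \<equiv> ennreal (share d j x)"

abbreviation \<nu> :: "(nat \<Rightarrow> real) \<Rightarrow> ennreal" where
  "\<nu> x \<equiv> ennreal (Rd_norm d x)"

lemma markov_operator_K: "markov_operator (state d) (K l)"
proof (rule markov_operator_avg[OF prob_space_waiting_time[OF h]])
  show "(\<lambda>(t, x). split_flow d \<beta> l t x) \<in> waiting_time h \<Otimes>\<^sub>M state d \<rightarrow>\<^sub>M state d"
    using measurable_split_flow[OF d, of \<beta> l]
    by (simp cong: measurable_cong_sets sets_pair_measure_cong add: sets_waiting_time)
qed

sublocale K: markov_operator "state d" "K l" for l
  by (rule markov_operator_K)

lemma measurable_along_flow:
  assumes "x \<in> Rd d" "\<phi> \<in> borel_measurable (state d)"
  shows "(\<lambda>t. \<phi> (split_flow d \<beta> l t x)) \<in> borel_measurable borel"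
proof -
  have "(\<lambda>t. split_flow d \<beta> l t x) \<in> borel \<rightarrow>\<^sub>M state d"
    using measurable_compose[OF measurable_Pair2' measurable_split_flow[OF d], of x] assms(1) by simp
  then show ?thesis using assms(2) by (rule measurable_compose)
qed

text \<open>
  Both rotated coordinates have the form of \<open>second_moment_random_rotation\<close>; for coordinate \<open>i\<close>
  the roles of \<open>v\<close> and \<open>u\<close> are taken by \<open>x\<^sub>i\<close> and \<open>- x\<^sub>n\<close>.
\<close>

lemma K_share_rotation:
  fixes x :: "nat \<Rightarrow> real"
  assumes i: "i \<in> {1..d}"
  defines "n \<equiv> cyc d (i + 1)" and "s \<equiv> 2 * x (cyc d (i - 1)) * h"
  shows "K (Coord i) (\<sigma> i) x = ennreal (((x i)\<^sup>2 + (x i + s * x n)\<^sup>2 / (1 + s\<^sup>2)) / (2 * Rd_norm d x))"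
    and "K (Coord i) (\<sigma> n) x = ennreal (((x n)\<^sup>2 + (x n - s * x i)\<^sup>2 / (1 + s\<^sup>2)) / (2 * Rd_norm d x))"
proof -
  let ?a = "x (cyc d (i - 1))"
  have n: "n \<in> {1..d}" "n \<noteq> i" using cyc_neighbours[of d i] d i by (simp_all add: n_def)
  have N: "Rd_norm d (split_flow d \<beta> (Coord i) t x) = Rd_norm d x" for t
    using Rd_norm_rotation[of d i t x] d i by simp
  have r: "1 / Rd_norm d x \<ge> 0" by simp
  have rot: "rotation d i t x i = x i * cos (?a * t) - (- x n) * sin (?a * t)"
    "rotation d i t x n = x n * cos (?a * t) - x i * sin (?a * t)" for t
    using i n unfolding rotation_def Let_def n_def[symmetric] by auto
  have "share d i (split_flow d \<beta> (Coord i) t x) = 1 / Rd_norm d x * (x i * cos (?a * t) - (- x n) * sin (?a * t))\<^sup>2" for t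
    unfolding share_def N using i rot(1)[of t] by simp
  then show "K (Coord i) (\<sigma> i) x = ennreal (((x i)\<^sup>2 + (x i + s * x n)\<^sup>2 / (1 + s\<^sup>2)) / (2 * Rd_norm d x))"
    unfolding avg_def using second_moment_random_rotation[OF h r, of "x i" ?a "- x n"] by (simp add: s_def)
  have "share d n (split_flow d \<beta> (Coord i) t x) = 1 / Rd_norm d x * (x n * cos (?a * t) - x i * sin (?a * t))\<^sup>2" for t
    unfolding share_def N using i rot(2)[of t] by simp
  then show "K (Coord i) (\<sigma> n) x = ennreal (((x n)\<^sup>2 + (x n - s * x i)\<^sup>2 / (1 + s\<^sup>2)) / (2 * Rd_norm d x))"
    unfolding avg_def using second_moment_random_rotation[OF h r, of "x n" ?a "x i"] by (simp add: s_def)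
qed

lemma K_share_keep:
  assumes i: "i \<in> {1..d}" and x: "x \<in> Rd d" and j: "j \<in> {1..d}"
  shows "ennreal (1 / 2) * \<sigma> j x \<le> K (Coord i) (\<sigma> j) x"
proof -
  define n where "n = cyc d (i + 1)"
  have half: "ennreal (1 / 2) * \<sigma> j x \<le> ennreal (((x j)\<^sup>2 + y) / (2 * Rd_norm d x))" if "y \<ge> 0" for y
  proof -
    have "1 / 2 * share d j x = (x j)\<^sup>2 / (2 * Rd_norm d x)" by (simp add: share_def)
    also have "\<dots> \<le> ((x j)\<^sup>2 + y) / (2 * Rd_norm d x)"
      using that by (intro divide_right_mono) auto
    finally show ?thesis by (subst ennreal_mult'[symmetric]) (auto intro: ennreal_leI)
  qed
  consider "j = i" | "j = n" | "j \<noteq> i" "j \<noteq> n" by blast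
  then show ?thesis
  proof cases
    case 1
    show ?thesis using half unfolding 1 K_share_rotation(1)[OF i] by simp
  next
    case 2
    show ?thesis using half unfolding 2 n_def K_share_rotation(2)[OF i] by simp
  next
    case 3
    have "share d j (split_flow d \<beta> (Coord i) t x) = share d j x" for t
    proof -
      have "rotation d i t x j = x j" using 3 j by (simp add: rotation_def Let_def n_def)
      then show ?thesis using i d Rd_norm_rotation[of d i t x] by (simp add: share_def)
    qed
    then have "K (Coord i) (\<sigma> j) x = K (Coord i) (\<lambda>_. \<sigma> j x) x"
      by (simp add: avg_def)
    also have "\<dots> = 1 * \<sigma> j x" using K.const x by simp
    finally have "K (Coord i) (\<sigma> j) x = \<sigma> j x" by simp
    moreover have "ennreal (1 / 2) * \<sigma> j x \<le> \<sigma> j x"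
      by (subst ennreal_mult'[symmetric]) (auto intro: ennreal_leI)
    ultimately show ?thesis by simp
  qed
qed

lemma K_share_transfer:
  assumes i: "i \<in> {1..d}"
  shows "ennreal (transfer_rate (2 * x (cyc d (i - 1)) * h) * share d i x) \<le> K (Coord i) (\<sigma> (cyc d (i + 1))) x"
proof -
  define s v where "s = 2 * x (cyc d (i - 1)) * h" and "v = x (cyc d (i + 1))"
  have "transfer_rate s * share d i x = transfer_rate s * (x i)\<^sup>2 / Rd_norm d x"
    by (simp add: share_def)
  also have "\<dots> \<le> (v\<^sup>2 + (v - s * x i)\<^sup>2 / (1 + s\<^sup>2)) / 2 / Rd_norm d x"
    by (intro divide_right_mono transfer_rate_le) simp
  also have "\<dots> = (v\<^sup>2 + (v - s * x i)\<^sup>2 / (1 + s\<^sup>2)) / (2 * Rd_norm d x)"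
    by simp
  finally show ?thesis
    unfolding K_share_rotation(2)[OF i] s_def[symmetric] v_def[symmetric] by (rule ennreal_leI)
qed

lemma K_Star_share:
  assumes x: "x \<in> Rd d" and j: "j \<in> {1..d}"
  shows "ennreal (1 / (1 + 2 * h)) * \<sigma> j x \<le> K Star (\<sigma> j) x + ennreal (3 * Rd_norm d \<beta> * h)"
proof -
  note [measurable] = measurable_along_flow[OF x, of _ Star, simplified split_flow.simps]
  have [measurable]: "share d j \<in> borel_measurable (state d)" using j by (rule measurable_share)
  have "ennreal (1 / (1 + 2 * h)) * \<sigma> j x = (\<integral>\<^sup>+ t. ennreal (exp (- 2 * t)) \<partial>waiting_time h) * \<sigma> j x"
    by (simp only: laplace_waiting_time[OF h])
  also have "\<dots> = (\<integral>\<^sup>+ t. ennreal (exp (- 2 * t)) * \<sigma> j x \<partial>waiting_time h)"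
    by (rule nn_integral_multc[symmetric]) simp
  also have "\<dots> \<le> (\<integral>\<^sup>+ t. \<sigma> j (drift d \<beta> t x) + ennreal (3 * Rd_norm d \<beta> * t) \<partial>waiting_time h)"
  proof (rule nn_integral_waiting_time_mono)
    fix t :: real assume t: "t \<ge> 0"
    have "exp (- 2 * t) * share d j x \<le> (if j = 1 then exp (- 2 * t) else 1) * share d j x"
      using t by (intro mult_right_mono) auto
    also have "\<dots> \<le> share d j (drift d \<beta> t x) + 3 * Rd_norm d \<beta> * t"
      using d by (intro share_drift t j) simp
    finally show "ennreal (exp (- 2 * t)) * \<sigma> j x \<le> \<sigma> j (drift d \<beta> t x) + ennreal (3 * Rd_norm d \<beta> * t)"
      using t by (simp flip: ennreal_mult' ennreal_plus add: ennreal_leI)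
  qed measurable
  also have "\<dots> = K Star (\<sigma> j) x + ennreal (3 * Rd_norm d \<beta> * h)"
    by (subst nn_integral_add) (auto simp: avg_def mean_waiting_time[OF h] cong: measurable_cong_sets)
  finally show ?thesis .
qed

text \<open>
  The average of \<open>Rd_norm_drift\<close> over the exponential time. The coefficient \<open>h / (1 + 2 h)\<close> is the mean of
  \<open>(1 - exp (- 2 t)) / 2\<close>.
\<close>

lemma K_Star_norm:
  assumes x: "x \<in> Rd d"
  shows "K Star \<nu> x + ennreal (h / (1 + 2 * h)) * \<sigma> 1 x \<le> \<nu> x + ennreal (Rd_norm d \<beta> * h)"
proof -
  interpret E: prob_space "waiting_time h" by (rule prob_space_waiting_time[OF h])
  note [measurable] = measurable_along_flow[OF x, of _ Star, simplified split_flow.simps]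
  define I where "I = (\<integral>\<^sup>+ t. ennreal ((1 - exp (- 2 * t)) / 2) \<partial>waiting_time h)"
  have total: "(\<integral>\<^sup>+ t. ennreal c \<partial>waiting_time h) = ennreal c" for c
    using E.emeasure_space_1 by simp
  have "I + ennreal (1 / (2 * (1 + 2 * h))) = ennreal (1 / 2)"
  proof -
    have "ennreal (1 / (2 * (1 + 2 * h))) = (\<integral>\<^sup>+ t. ennreal (1 / 2) * ennreal (exp (- 2 * t)) \<partial>waiting_time h)"
      using h by (subst nn_integral_cmult, simp cong: measurable_cong_sets)
        (unfold laplace_waiting_time[OF h], subst ennreal_mult'[symmetric], simp_all add: mult.commute)
    then have "I + ennreal (1 / (2 * (1 + 2 * h))) =
        (\<integral>\<^sup>+ t. ennreal ((1 - exp (- 2 * t)) / 2) + ennreal (1 / 2) * ennreal (exp (- 2 * t)) \<partial>waiting_time h)"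
      unfolding I_def by (subst nn_integral_add) (auto cong: measurable_cong_sets)
    also have "\<dots> = (\<integral>\<^sup>+ t. ennreal (1 / 2) \<partial>waiting_time h)"
    proof (rule antisym; rule nn_integral_waiting_time_mono)
      fix t :: real assume "t \<ge> 0"
      then have "ennreal ((1 - exp (- 2 * t)) / 2) + ennreal (1 / 2) * ennreal (exp (- 2 * t)) = ennreal (1 / 2)"
        by (subst ennreal_mult'[symmetric], simp, subst ennreal_plus[symmetric]) (auto simp: field_simps)
      then show "ennreal ((1 - exp (- 2 * t)) / 2) + ennreal (1 / 2) * ennreal (exp (- 2 * t)) \<le> ennreal (1 / 2)"
        "ennreal (1 / 2) \<le> ennreal ((1 - exp (- 2 * t)) / 2) + ennreal (1 / 2) * ennreal (exp (- 2 * t))"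
        by simp_all
    qed measurable
    finally show ?thesis by (simp only: total)
  qed
  moreover have "ennreal (1 / 2) = ennreal (h / (1 + 2 * h)) + ennreal (1 / (2 * (1 + 2 * h)))"
  proof -
    have "h / (1 + 2 * h) + 1 / (2 * (1 + 2 * h)) = (2 * h) / (2 * (1 + 2 * h)) + 1 / (2 * (1 + 2 * h))"
      by (subst mult_divide_mult_cancel_left) simp_all
    also have "\<dots> = (1 + 2 * h) / (2 * (1 + 2 * h))" by (simp only: add_divide_distrib[symmetric] add.commute)
    also have "\<dots> = 1 / 2" using h by simp
    finally have eq: "h / (1 + 2 * h) + 1 / (2 * (1 + 2 * h)) = 1 / 2" .
    show ?thesis using h by (subst eq[symmetric], intro ennreal_plus) auto
  qed
  ultimately have I: "I = ennreal (h / (1 + 2 * h))"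
    using ennreal_add_left_cancel[of "ennreal (1 / (2 * (1 + 2 * h)))" I "ennreal (h / (1 + 2 * h))"]
    by (simp add: add.commute)
  have "K Star \<nu> x + I * \<sigma> 1 x = (\<integral>\<^sup>+ t. \<nu> (drift d \<beta> t x) + ennreal ((1 - exp (- 2 * t)) / 2) * \<sigma> 1 x \<partial>waiting_time h)"
    unfolding I_def avg_def split_flow.simps
    by (subst nn_integral_multc[symmetric], simp, subst nn_integral_add) (auto cong: measurable_cong_sets)
  also have "\<dots> \<le> (\<integral>\<^sup>+ t. \<nu> x + ennreal (Rd_norm d \<beta> * t) \<partial>waiting_time h)"
  proof (rule nn_integral_waiting_time_mono)
    fix t :: real assume t: "t \<ge> 0"
    then show "\<nu> (drift d \<beta> t x) + ennreal ((1 - exp (- 2 * t)) / 2) * \<sigma> 1 x \<le> \<nu> x + ennreal (Rd_norm d \<beta> * t)"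
      using Rd_norm_drift[of d t \<beta> x] d by (simp flip: ennreal_mult' ennreal_plus add: ennreal_leI)
  qed measurable
  also have "\<dots> = \<nu> x + ennreal (Rd_norm d \<beta> * h)"
    by (subst nn_integral_add) (auto simp: mean_waiting_time[OF h] total[simplified] cong: measurable_cong_sets)
  finally show ?thesis unfolding I .
qed

lemma K_norm:
  assumes l: "l \<in> labels d" and x: "x \<in> Rd d"
  shows "K l \<nu> x \<le> \<nu> x + ennreal (Rd_norm d \<beta> * h)"
proof (cases l)
  case (Coord i)
  with l have i: "i \<in> {1..d}" by (auto simp: labels_def)
  have "Rd_norm d (split_flow d \<beta> l t x) = Rd_norm d x" for t
    using Rd_norm_rotation[of d i t x] d i by (simp add: Coord)
  then have "K l \<nu> x = K l (\<lambda>_. \<nu> x) x" by (simp add: avg_def)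
  also have "\<dots> = \<nu> x" using K.const x by simp
  finally show ?thesis by simp
next
  case Star
  have "K Star \<nu> x \<le> K Star \<nu> x + ennreal (h / (1 + 2 * h)) * \<sigma> 1 x" by simp
  also note K_Star_norm[OF x]
  finally show ?thesis by (simp add: Star)
qed

lemma feeds_keep:
  assumes l: "l \<in> labels d" and j: "j \<in> {1..d}"
  shows "feeds (state d) (K l) (\<sigma> j) (\<sigma> j)"
proof (cases l)
  case (Coord i)
  with l have i: "i \<in> {1..d}" by (auto simp: labels_def)
  show ?thesis
    unfolding Coord using K_share_keep[OF i _ j] by (intro feedsI[of "1 / 2" _ _ _ _ 0]) auto
next
  case Star
  show ?thesis
    unfolding Star using K_Star_share[OF _ j] h by (intro feedsI[of "1 / (1 + 2 * h)"]) auto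
qed

text \<open>
  The rotation \<open>k\<close> turns with the speed \<open>x\<^sub>p\<close>, where \<open>p\<close> precedes \<open>k\<close>. The preceding flow of \<open>V\<^sub>\<star>\<close>
  makes the transfer rate bounded below on average, uniformly in the starting point, by
  \<open>drift_leaves_zero\<close>. For \<open>k \<noteq> 1\<close> the flow of \<open>V\<^sub>\<star>\<close> changes the share of \<open>k\<close> only by translation, so the
  error is additive.
\<close>

lemma feeds_transfer:
  assumes k: "k \<in> {1..d}" "k \<noteq> 1"
  shows "feeds (state d) (\<lambda>\<phi>. K Star (K (Coord k) \<phi>)) (\<sigma> k) (\<sigma> (cyc d (k + 1)))"
proof -
  define p where "p = cyc d (k - 1)"
  have p: "p \<in> {1..d}" "cyc d (k + 1) \<in> {1..d}" using cyc_neighbours[of d k] d k by (auto simp: p_def)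
  define m where "m = transfer_rate (2 * (\<bar>\<beta> p\<bar> / 4) * h)"
  have m: "m > 0" unfolding m_def using \<beta>[OF p(1)] h by (intro transfer_rate_pos) simp
  have [measurable]: "\<sigma> (cyc d (k + 1)) \<in> borel_measurable (state d)" "\<sigma> k \<in> borel_measurable (state d)"
    using p k by (auto intro!: measurable_compose[OF measurable_share])
  have e: "0 < 1 + exp (1 / h)" by (simp add: add_pos_pos)
  show ?thesis
  proof (rule feedsI)
    show "m / (1 + exp (1 / h)) > 0" using m e by simp
    fix x assume "x \<in> space (state d)"
    then have x: "x \<in> Rd d" by simp
    note [measurable] = measurable_along_flow[OF x, of _ Star, simplified split_flow.simps] K.measurable_apply
    define g where "g t = transfer_rate (2 * drift d \<beta> t x p * h)" for t
    have [measurable]: "g \<in> borel_measurable borel"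
      using p unfolding g_def transfer_rate_def drift_def by (cases "p = 1") simp_all
    have g_nonneg: "0 \<le> g t" for t unfolding g_def by (rule transfer_rate_bounds)
    have "m \<le> g t + g (t + 1)" for t
    proof -
      have "m \<le> transfer_rate (2 * y * h)" if "\<bar>\<beta> p\<bar> / 4 \<le> \<bar>y\<bar>" for y
        unfolding m_def using that h by (intro transfer_rate_mono) (simp add: abs_mult)
      moreover have "\<bar>\<beta> p\<bar> / 4 \<le> \<bar>drift d \<beta> t x p\<bar> \<or> \<bar>\<beta> p\<bar> / 4 \<le> \<bar>drift d \<beta> (t + 1) x p\<bar>"
        using drift_leaves_zero[OF p(1), of \<beta> t x] by linarith
      moreover have "0 \<le> g t" "0 \<le> g (t + 1)" unfolding g_def by (rule transfer_rate_bounds)+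
      ultimately show ?thesis unfolding g_def by (smt (verit))
    qed
    then have "ennreal (m / (1 + exp (1 / h))) \<le> (\<integral>\<^sup>+ t. ennreal (g t) \<partial>waiting_time h)"
      by (intro nn_integral_waiting_time_ge_half[OF h]) (auto simp: g_nonneg)
    then have "ennreal (m / (1 + exp (1 / h))) * \<sigma> k x \<le> (\<integral>\<^sup>+ t. ennreal (g t) \<partial>waiting_time h) * \<sigma> k x"
      by (rule mult_right_mono) simp
    also have "\<dots> = (\<integral>\<^sup>+ t. ennreal (g t) * \<sigma> k x \<partial>waiting_time h)"
      by (rule nn_integral_multc[symmetric]) (simp cong: measurable_cong_sets)
    also have "\<dots> \<le> (\<integral>\<^sup>+ t. K (Coord k) (\<sigma> (cyc d (k + 1))) (drift d \<beta> t x) + ennreal (3 * Rd_norm d \<beta> * t) \<partial>waiting_time h)"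
    proof (rule nn_integral_waiting_time_mono)
      fix t :: real assume t: "t \<ge> 0"
      have g: "0 \<le> g t" "g t \<le> 1" unfolding g_def by (rule transfer_rate_bounds)+
      have "g t * share d k x \<le> g t * (share d k (drift d \<beta> t x) + 3 * Rd_norm d \<beta> * t)"
        using share_drift[of d t k x \<beta>] d k t g by (intro mult_left_mono) auto
      \<comment> \<open>The rate is at most \<open>1\<close>, so it does not enlarge the additive error.\<close>
      also have "\<dots> \<le> g t * share d k (drift d \<beta> t x) + 1 * (3 * Rd_norm d \<beta> * t)"
        unfolding distrib_left using g t by (intro add_left_mono mult_right_mono) auto
      finally have "ennreal (g t * share d k x) \<le> ennreal (g t * share d k (drift d \<beta> t x) + 1 * (3 * Rd_norm d \<beta> * t))"
        by (rule ennreal_leI)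
      also have "\<dots> = ennreal (g t * share d k (drift d \<beta> t x)) + ennreal (3 * Rd_norm d \<beta> * t)"
        using g t by (subst ennreal_plus) auto
      also have "\<dots> \<le> K (Coord k) (\<sigma> (cyc d (k + 1))) (drift d \<beta> t x) + ennreal (3 * Rd_norm d \<beta> * t)"
        unfolding g_def p_def by (intro add_right_mono K_share_transfer k)
      finally show "ennreal (g t) * \<sigma> k x \<le> \<dots>" using g by (simp add: ennreal_mult')
    qed measurable
    also have "\<dots> = K Star (K (Coord k) (\<sigma> (cyc d (k + 1)))) x + ennreal (3 * Rd_norm d \<beta> * h)"
      unfolding avg_def[of _ "split_flow d \<beta> Star"] split_flow.simps(2)
      by (subst nn_integral_add) (auto simp: mean_waiting_time[OF h] cong: measurable_cong_sets)
    finally show "ennreal (m / (1 + exp (1 / h))) * \<sigma> k x \<le> \<dots>" .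
  qed
qed

section \<open>One step of the random splitting\<close>

definition step_map :: "step_noise \<Rightarrow> (nat \<Rightarrow> real) \<Rightarrow> nat \<Rightarrow> real" where
  "step_map = (\<lambda>(u, \<tau>). fold (\<lambda>k. split_flow d \<beta> (u ! k) (\<tau> k)) [0..<d + 1])"

abbreviation perms :: "field_label list set" where
  "perms \<equiv> permutations_of_set (labels d)"

abbreviation times :: "nat \<Rightarrow> (nat \<Rightarrow> real) measure" where
  "times m \<equiv> \<Pi>\<^sub>M k\<in>{..<m}. waiting_time h"

lemma finite_labels: "finite (labels d)" "card (labels d) = d + 1"
proof -
  show "finite (labels d)" by (simp add: labels_def)
  have "card (Coord ` {1..d}) = d" by (subst card_image) (auto simp: inj_on_def)
  then show "card (labels d) = d + 1"
    unfolding labels_def by (subst card_insert_disjoint) auto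
qed

lemma permsD: "u \<in> perms \<Longrightarrow> length u = d + 1" "u \<in> perms \<Longrightarrow> set u = labels d"
  using length_finite_permutations_of_set[of u "labels d"] permutations_of_setD[of u "labels d"]
  by (simp_all add: finite_labels)

lemma step_noise_eq: "step_noise d h = measure_pmf (pmf_of_set perms) \<Otimes>\<^sub>M times (d + 1)"
  by (simp add: step_noise_def waiting_time_def)

lemma prob_space_times: "prob_space (times m)"
  by (intro prob_space_PiM prob_space_waiting_time h)

lemma prob_space_step_noise: "prob_space (step_noise d h)"
  unfolding step_noise_eq by (intro prob_space_pair prob_space_times prob_space_measure_pmf)

lemma measurable_fold_flows:
  assumes "m \<le> n"
  shows "(\<lambda>(\<tau>, x). fold (\<lambda>k. split_flow d \<beta> (u k) (\<tau> k)) [0..<m] x) \<in> times n \<Otimes>\<^sub>M state d \<rightarrow>\<^sub>M state d"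
  using assms
proof (induction m)
  case 0
  then show ?case by (simp add: split_beta)
next
  case (Suc m)
  have [measurable]: "(\<lambda>p. fold (\<lambda>k. split_flow d \<beta> (u k) (fst p k)) [0..<m] (snd p)) \<in> times n \<Otimes>\<^sub>M state d \<rightarrow>\<^sub>M state d"
    using Suc by (simp add: split_beta)
  have "(\<lambda>\<tau>. \<tau> m) \<in> times n \<rightarrow>\<^sub>M waiting_time h"
    using Suc.prems by (intro measurable_component_singleton) simp
  then have [measurable]: "(\<lambda>\<tau>. \<tau> m) \<in> times n \<rightarrow>\<^sub>M borel"
    by (simp cong: measurable_cong_sets add: sets_waiting_time)
  have "(\<lambda>p. (\<lambda>(t, x). split_flow d \<beta> (u m) t x) (fst p m, fold (\<lambda>k. split_flow d \<beta> (u k) (fst p k)) [0..<m] (snd p)))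
    \<in> times n \<Otimes>\<^sub>M state d \<rightarrow>\<^sub>M state d"
    by (rule measurable_compose[OF _ measurable_split_flow[OF d]]) measurable
  then show ?case by (simp add: split_beta)
qed

text \<open>
  The times are independent, so integrating out the last one first replaces the last flow by its average.
\<close>

lemma nn_integral_fold_flows:
  assumes "\<phi> \<in> borel_measurable (state d)" "x \<in> Rd d"
  shows "(\<integral>\<^sup>+ \<tau>. \<phi> (fold (\<lambda>k. split_flow d \<beta> (u k) (\<tau> k)) [0..<m] x) \<partial>times m) =
    foldr K (map u [0..<m]) \<phi> x"
  using assms(1)
proof (induction m arbitrary: \<phi>)
  case 0
  interpret T: prob_space "times 0" by (rule prob_space_times)
  show ?case using T.emeasure_space_1 by simp
next
  case (Suc m)
  interpret product_sigma_finite "\<lambda>_. waiting_time h"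
    unfolding product_sigma_finite_def using prob_space_waiting_time[OF h] prob_space_imp_sigma_finite by blast
  have ins: "{..<Suc m} = insert m {..<m}" by auto
  let ?f = "\<lambda>\<tau>. \<phi> (fold (\<lambda>k. split_flow d \<beta> (u k) (\<tau> k)) [0..<Suc m] x)"
  have "(\<lambda>\<tau>. fold (\<lambda>k. split_flow d \<beta> (u k) (\<tau> k)) [0..<Suc m] x) \<in> times (Suc m) \<rightarrow>\<^sub>M state d"
    using measurable_compose[OF measurable_Pair2' measurable_fold_flows[where m = "Suc m" and u = u, OF order_refl], of x] assms(2)
    by simp
  then have meas: "?f \<in> borel_measurable (Pi\<^sub>M (insert m {..<m}) (\<lambda>_. waiting_time h))"
    using Suc.prems unfolding ins[symmetric] by (rule measurable_compose)
  have "(\<integral>\<^sup>+ \<tau>. ?f \<tau> \<partial>times (Suc m)) = (\<integral>\<^sup>+ \<tau>. \<integral>\<^sup>+ t. ?f (\<tau>(m := t)) \<partial>waiting_time h \<partial>times m)"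
    unfolding ins by (rule product_nn_integral_insert[OF _ _ meas]) auto
  also have "\<dots> = (\<integral>\<^sup>+ \<tau>. K (u m) \<phi> (fold (\<lambda>k. split_flow d \<beta> (u k) (\<tau> k)) [0..<m] x) \<partial>times m)"
  proof (intro nn_integral_cong)
    fix \<tau>
    have "fold (\<lambda>k. split_flow d \<beta> (u k) ((\<tau>(m := t)) k)) [0..<m] x = fold (\<lambda>k. split_flow d \<beta> (u k) (\<tau> k)) [0..<m] x" for t
      by (intro fold_cong) auto
    then show "(\<integral>\<^sup>+ t. ?f (\<tau>(m := t)) \<partial>waiting_time h) = K (u m) \<phi> (fold (\<lambda>k. split_flow d \<beta> (u k) (\<tau> k)) [0..<m] x)"
      by (simp add: avg_def)
  qed
  also have "\<dots> = foldr K (map u [0..<m]) (K (u m) \<phi>) x"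
    by (rule Suc.IH[OF K.measurable_apply[OF Suc.prems]])
  finally show ?case by simp
qed

abbreviation P :: "((nat \<Rightarrow> real) \<Rightarrow> ennreal) \<Rightarrow> (nat \<Rightarrow> real) \<Rightarrow> ennreal" where
  "P \<equiv> avg (step_noise d h) step_map"

text \<open>
  The lists of labels form a countable set, so joint measurability can be checked for a fixed list.
\<close>

lemma measurable_step_map [measurable]:
  "(\<lambda>(z, x). step_map z x) \<in> step_noise d h \<Otimes>\<^sub>M state d \<rightarrow>\<^sub>M state d"
proof -
  let ?g = "\<lambda>(u, p). (\<lambda>(\<tau>, x). fold (\<lambda>k. split_flow d \<beta> (u ! k) (\<tau> k)) [0..<d + 1] x) p"
  have g: "?g \<in> count_space UNIV \<Otimes>\<^sub>M (times (d + 1) \<Otimes>\<^sub>M state d) \<rightarrow>\<^sub>M state d"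
    using measurable_fold_flows[of "d + 1" "d + 1"]
    by (intro measurable_pair_measure_countable1 countable_field_label_lists) simp
  have "(\<lambda>p. (fst (fst p), (snd (fst p), snd p))) \<in>
      (measure_pmf (pmf_of_set perms) \<Otimes>\<^sub>M times (d + 1)) \<Otimes>\<^sub>M state d \<rightarrow>\<^sub>M
      count_space UNIV \<Otimes>\<^sub>M (times (d + 1) \<Otimes>\<^sub>M state d)"
    by (intro measurable_Pair measurable_compose[OF measurable_fst measurable_fst]
        measurable_compose[OF measurable_fst measurable_snd] measurable_snd
        measurable_compose[OF measurable_compose[OF measurable_fst measurable_fst]]) auto
  from measurable_compose[OF this g] show ?thesis
    unfolding step_noise_eq step_map_def split_beta by (simp only: fst_conv snd_conv)
qed

sublocale P: markov_operator "state d" P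
  by (rule markov_operator_avg[OF prob_space_step_noise measurable_step_map])

lemma P_eq:
  assumes \<phi>: "\<phi> \<in> borel_measurable (state d)" and x: "x \<in> Rd d"
  shows "P \<phi> x = (\<integral>\<^sup>+ u. foldr K u \<phi> x \<partial>measure_pmf (pmf_of_set perms))"
proof -
  interpret T: prob_space "times (d + 1)" by (rule prob_space_times)
  have "(\<lambda>z. step_map z x) \<in> step_noise d h \<rightarrow>\<^sub>M state d"
    using measurable_compose[OF measurable_Pair2' measurable_step_map, of x] x by simp
  then have m: "(\<lambda>z. \<phi> (step_map z x)) \<in> borel_measurable (measure_pmf (pmf_of_set perms) \<Otimes>\<^sub>M times (d + 1))"
    using \<phi> unfolding step_noise_eq by (rule measurable_compose)
  have "P \<phi> x = (\<integral>\<^sup>+ u. \<integral>\<^sup>+ \<tau>. \<phi> (step_map (u, \<tau>) x) \<partial>times (d + 1) \<partial>measure_pmf (pmf_of_set perms))"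
    unfolding avg_def step_noise_eq by (rule T.nn_integral_fst[OF m, symmetric])
  also have "\<dots> = (\<integral>\<^sup>+ u. foldr K u \<phi> x \<partial>measure_pmf (pmf_of_set perms))"
  proof (intro nn_integral_cong_AE AE_pmfI)
    fix u assume "u \<in> set_pmf (pmf_of_set perms)"
    then have "u \<in> perms" by (simp add: finite_labels)
    then have "map ((!) u) [0..<d + 1] = u" using permsD(1) by (metis map_nth)
    then show "(\<integral>\<^sup>+ \<tau>. \<phi> (step_map (u, \<tau>) x) \<partial>times (d + 1)) = foldr K u \<phi> x"
      using nn_integral_fold_flows[where u = "(!) u" and m = "d + 1", OF \<phi> x] unfolding step_map_def prod.case by metis
  qed
  finally show ?thesis .
qed

text \<open>
  A single order of the fields suffices, as it occurs with positive probability and everything is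
  nonnegative.
\<close>

lemma feeds_P:
  assumes u: "u \<in> perms" and f: "feeds (state d) (foldr K u) \<phi> \<psi>" and m: "\<psi> \<in> borel_measurable (state d)"
  shows "feeds (state d) P \<phi> \<psi>"
proof -
  define w where "w = pmf (pmf_of_set perms) u"
  have w: "w > 0" unfolding w_def using u by (simp add: finite_labels pmf_positive_iff)
  obtain c C where c: "c > 0" "\<And>x. x \<in> Rd d \<Longrightarrow> ennreal c * \<phi> x \<le> foldr K u \<psi> x + ennreal C"
    using f unfolding feeds_def by auto
  show ?thesis
  proof (rule feedsI)
    show "w * c > 0" using w c by simp
    fix x assume "x \<in> space (state d)"
    then have x: "x \<in> Rd d" by simp
    have "ennreal (w * c) * \<phi> x = ennreal w * (ennreal c * \<phi> x)"
      using w c(1) by (simp add: ennreal_mult mult.assoc)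
    also have "\<dots> \<le> ennreal w * foldr K u \<psi> x + ennreal (w * C)"
      using w mult_left_mono[OF c(2)[OF x], of "ennreal w"] by (simp add: distrib_left ennreal_mult')
    also have "ennreal w * foldr K u \<psi> x \<le> P \<psi> x"
      unfolding P_eq[OF m x] w_def nn_integral_measure_pmf
      using nn_integral_ge_point[of u UNIV "\<lambda>u. ennreal (pmf (pmf_of_set perms) u) * foldr K u \<psi> x"] by simp
    finally show "ennreal (w * c) * \<phi> x \<le> P \<psi> x + ennreal (w * C)" by simp
  qed
qed

lemma measurable_\<sigma> [measurable]: "j \<in> {1..d} \<Longrightarrow> \<sigma> j \<in> borel_measurable (state d)"
  by (intro measurable_compose[OF measurable_share]) auto

lemma feeds_foldr_keep: "set ls \<subseteq> labels d \<Longrightarrow> j \<in> {1..d} \<Longrightarrow> feeds (state d) (foldr K ls) (\<sigma> j) (\<sigma> j)"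
  by (intro feeds_foldr markov_operator_K feeds_keep measurable_\<sigma>) auto

lemma feeds_P_keep:
  assumes "j \<in> {1..d}"
  shows "feeds (state d) P (\<sigma> j) (\<sigma> j)"
proof -
  obtain u where u: "u \<in> perms" using finite_labels(1) permutations_of_set_empty_iff by blast
  show ?thesis
    using assms permsD(2)[OF u] by (intro feeds_P[OF u] feeds_foldr_keep) auto
qed

text \<open>
  In the favourable order \<open>V\<^sub>\<star>\<close> acts first and the rotation \<open>k\<close> second; the share of \<open>k + 1\<close> then
  persists under the remaining flows.
\<close>

lemma feeds_P_transfer:
  assumes k: "k \<in> {1..d}" "k \<noteq> 1"
  shows "feeds (state d) P (\<sigma> k) (\<sigma> (cyc d (k + 1)))"
proof -
  have n: "cyc d (k + 1) \<in> {1..d}" using cyc_neighbours[of d k] d k by auto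
  obtain ls where ls: "set ls = labels d - {Star, Coord k}" "distinct ls"
    using finite_distinct_list[of "labels d - {Star, Coord k}"] finite_labels by auto
  have u: "Star # Coord k # ls \<in> perms" using ls k by (intro permutations_of_setI) (auto simp: labels_def)
  have "feeds (state d) (\<lambda>\<phi>. K Star (K (Coord k) (foldr K ls \<phi>))) (\<sigma> k) (\<sigma> (cyc d (k + 1)))"
    using ls k n
    by (intro feeds_comp[OF markov_operator_comp[OF markov_operator_K[of Star] markov_operator_K[of "Coord k"]] markov_operator_foldr[of ls "state d" K]
          feeds_transfer[OF k] feeds_foldr_keep] markov_operator_K) auto
  then show ?thesis using n by (intro feeds_P[OF u]) (auto simp: o_def)
qed

lemma foldr_norm:
  assumes "set ls \<subseteq> labels d" "x \<in> Rd d"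
  shows "foldr K ls \<nu> x \<le> \<nu> x + ennreal (length ls * (Rd_norm d \<beta> * h))"
  using assms
proof (induction ls arbitrary: x)
  case Nil
  then show ?case by simp
next
  case (Cons l ls)
  let ?b = "Rd_norm d \<beta> * h"
  have "foldr K (l # ls) \<nu> x \<le> K l (\<lambda>y. \<nu> y + ennreal (length ls * ?b)) x"
    using Cons by (auto intro!: K.mono)
  also have "\<dots> = K l \<nu> x + ennreal (length ls * ?b)"
    using Cons.prems by (subst K.add) (auto simp: K.const)
  also have "\<dots> \<le> \<nu> x + ennreal ?b + ennreal (length ls * ?b)"
    using Cons.prems by (intro add_right_mono K_norm) auto
  also have "\<dots> = \<nu> x + ennreal (length (l # ls) * ?b)"
    using h by (simp add: add.assoc distrib_right ennreal_plus[symmetric] del: ennreal_plus)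
  finally show ?case .
qed

text \<open>
  If \<open>V\<^sub>\<star>\<close> acts first, which happens with positive probability, the norm decreases by a multiple of the
  first share at the start of the step. For all other orders the bounded growth of the norm is
  enough.
\<close>

lemma P_norm:
  obtains c C where "c > 0" "C \<ge> 0"
    "\<And>x. x \<in> Rd d \<Longrightarrow> P \<nu> x + ennreal c * \<sigma> 1 x \<le> \<nu> x + ennreal C"
proof -
  obtain ls where ls: "set ls = labels d - {Star}" "distinct ls"
    using finite_distinct_list[of "labels d - {Star}"] finite_labels by auto
  let ?u0 = "Star # ls"
  have u0: "?u0 \<in> perms" using ls by (intro permutations_of_setI) (auto simp: labels_def)
  define w where "w = pmf (pmf_of_set perms) ?u0"
  have w: "w > 0" unfolding w_def using u0 by (simp add: finite_labels pmf_positive_iff)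
  define a where "a = h / (1 + 2 * h)"
  have a: "a > 0" using h by (simp add: a_def)
  define C where "C = (d + 1) * (Rd_norm d \<beta> * h)"
  have m: "\<nu> \<in> borel_measurable (state d)" by simp
  have main: "P \<nu> x + ennreal (a * w) * \<sigma> 1 x \<le> \<nu> x + ennreal C" if x: "x \<in> Rd d" for x
  proof -
    have first: "foldr K ?u0 \<nu> x + ennreal a * \<sigma> 1 x \<le> \<nu> x + ennreal C"
    proof -
      let ?b = "Rd_norm d \<beta> * h"
      have len: "length ls = d" using permsD(1)[OF u0] by simp
      have "foldr K ?u0 \<nu> x \<le> K Star (\<lambda>y. \<nu> y + ennreal (length ls * ?b)) x"
        unfolding foldr.simps o_apply using ls(1) x by (intro K.mono foldr_norm) simp_all
      also have "\<dots> = K Star \<nu> x + ennreal (d * ?b)"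
        using x by (subst K.add) (auto simp: K.const len)
      finally have "foldr K ?u0 \<nu> x + ennreal a * \<sigma> 1 x \<le> (K Star \<nu> x + ennreal a * \<sigma> 1 x) + ennreal (d * ?b)"
        by (simp add: add_right_mono ac_simps)
      also have "\<dots> \<le> (\<nu> x + ennreal ?b) + ennreal (d * ?b)"
        unfolding a_def by (intro add_right_mono K_Star_norm x)
      also have "\<dots> = \<nu> x + ennreal C"
        using h by (simp add: C_def add.assoc distrib_right ennreal_plus[symmetric] add.commute del: ennreal_plus)
      finally show ?thesis .
    qed
    have "(\<integral>\<^sup>+ u. (ennreal a * \<sigma> 1 x) * indicator {?u0} u \<partial>measure_pmf (pmf_of_set perms)) = ennreal (a * w) * \<sigma> 1 x"
      using a w by (subst nn_integral_cmult_indicator, simp)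
        (simp add: emeasure_pmf_single flip: w_def, simp add: ennreal_mult ac_simps)
    then have "P \<nu> x + ennreal (a * w) * \<sigma> 1 x =
        (\<integral>\<^sup>+ u. foldr K u \<nu> x + (ennreal a * \<sigma> 1 x) * indicator {?u0} u \<partial>measure_pmf (pmf_of_set perms))"
      by (subst nn_integral_add) (simp_all add: P_eq[OF m x])
    also have "\<dots> \<le> (\<integral>\<^sup>+ u. \<nu> x + ennreal C \<partial>measure_pmf (pmf_of_set perms))"
    proof (intro nn_integral_mono_AE AE_pmfI)
      fix u assume "u \<in> set_pmf (pmf_of_set perms)"
      then have u: "u \<in> perms" by (simp add: finite_labels)
      show "foldr K u \<nu> x + (ennreal a * \<sigma> 1 x) * indicator {?u0} u \<le> \<nu> x + ennreal C"
      proof (cases "u = ?u0")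
        case True
        then show ?thesis using first by simp
      next
        case False
        then show ?thesis using foldr_norm[of u x] permsD[OF u] x by (simp add: C_def)
      qed
    qed
    also have "\<dots> = \<nu> x + ennreal C" by simp
    finally show ?thesis .
  qed
  show ?thesis
    using h a w by (intro that[OF _ _ main]) (auto simp: C_def)
qed

section \<open>Iterated steps\<close>

lemma markov_operator_P_pow: "markov_operator (state d) (P ^^ n)"
  by (rule markov_operator_funpow[OF P.markov_operator_axioms])

text \<open>
  The share of \<open>k \<noteq> 1\<close> needs \<open>d + 1 - k\<close> transfers to reach coordinate \<open>d + 1 = 1\<close>. Whenever there are
  steps to spare, it persists where it is.
\<close>

lemma feeds_P_pow:
  assumes "k \<in> {1..d}" "k = 1 \<or> d + 1 \<le> n + k"
  shows "feeds (state d) (P ^^ n) (\<sigma> k) (\<sigma> 1)"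
  using assms
proof (induction n arbitrary: k)
  case 0
  then have "k = 1" by auto
  then show ?case using feeds_id[of "state d" "\<sigma> 1"] by (simp add: id_def)
next
  case (Suc n)
  have d1: "1 \<in> {1..d}" using d by simp
  have "\<exists>j\<in>{1..d}. feeds (state d) P (\<sigma> k) (\<sigma> j) \<and> (j = 1 \<or> d + 1 \<le> n + j)"
  proof (cases "k = 1")
    case True
    then show ?thesis using feeds_P_keep[OF d1] d1 by blast
  next
    case False
    then show ?thesis
      using feeds_P_transfer[OF Suc.prems(1) False] cyc_simps(1)[of d k] cyc_neighbours(1)[of d k] d Suc.prems
      by (intro bexI[of _ "cyc d (k + 1)"]) auto
  qed
  then obtain j where j: "j \<in> {1..d}" "feeds (state d) P (\<sigma> k) (\<sigma> j)" "j = 1 \<or> d + 1 \<le> n + j" by blast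
  have "feeds (state d) (\<lambda>\<phi>. P ((P ^^ n) \<phi>)) (\<sigma> k) (\<sigma> 1)"
    by (rule feeds_comp[OF P.markov_operator_axioms markov_operator_P_pow j(2) Suc.IH[OF j(1,3)]])
      (use j d1 in auto)
  then show ?case by (simp add: o_def)
qed

lemma feeds_norm_P_pow: "feeds (state d) (P ^^ d) \<nu> (\<sigma> 1)"
proof -
  have "feeds (state d) (P ^^ d) (\<lambda>x. \<Sum>k=1..d. \<sigma> k x) (\<sigma> 1)"
    by (intro feeds_sum feeds_P_pow) auto
  moreover have "(\<Sum>k=1..d. \<sigma> k x) = \<nu> x" for x
    by (simp add: sum_share)
  ultimately show ?thesis by simp
qed

text \<open>
  After \<open>d\<close> steps the mean first share is at least a multiple of \<open>|x|\<close>, and the dissipation in the last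
  step subtracts a multiple of it from the mean norm.
\<close>

lemma P_pow_norm:
  obtains \<alpha> f where "0 < \<alpha>" "\<alpha> < 1" "0 < f"
    "\<And>x. x \<in> Rd d \<Longrightarrow> (P ^^ (d + 1)) (\<lambda>y. ennreal (lyapunov d y)) x \<le> ennreal (\<alpha> * lyapunov d x + f)"
proof -
  obtain c C where c: "c > 0" "C \<ge> 0"
    and P: "\<And>x. x \<in> Rd d \<Longrightarrow> P \<nu> x + ennreal c * \<sigma> 1 x \<le> \<nu> x + ennreal C"
    using P_norm by blast
  obtain a A where a: "a > 0" "\<And>x. x \<in> Rd d \<Longrightarrow> ennreal a * \<nu> x \<le> (P ^^ d) (\<sigma> 1) x + ennreal A"
    using feeds_norm_P_pow unfolding feeds_def by auto
  define B where "B = max 0 A"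
  have aB: "ennreal a * \<nu> x \<le> (P ^^ d) (\<sigma> 1) x + ennreal B" if "x \<in> Rd d" for x
    using a(2)[OF that] by (simp add: B_def ennreal_max_0)
  interpret Pn: markov_operator "state d" "P ^^ n" for n by (rule markov_operator_P_pow)
  have d1: "1 \<in> {1..d}" using d by simp
  have pow: "(P ^^ n) \<nu> x \<le> \<nu> x + ennreal (n * C)" if "x \<in> Rd d" for n x
    using that
  proof (induction n arbitrary: x)
    case 0
    then show ?case by simp
  next
    case (Suc n)
    have "(P ^^ Suc n) \<nu> x \<le> P (\<lambda>y. \<nu> y + ennreal (n * C)) x"
      using Suc by (auto intro!: P.mono)
    also have "\<dots> = P \<nu> x + ennreal (n * C)"
      using Suc.prems by (subst P.add) (auto simp: P.const)
    also have "\<dots> \<le> (\<nu> x + ennreal C) + ennreal (n * C)"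
      using P[OF Suc.prems] by (intro add_right_mono) (auto elim: order_trans[rotated])
    also have "\<dots> = \<nu> x + ennreal (Suc n * C)"
      using c by (simp add: add.assoc distrib_right ennreal_plus[symmetric] del: ennreal_plus)
    finally show ?case .
  qed
  define D where "D = (d + 1) * C + c * B"
  have D: "D \<ge> 0" using c by (simp add: D_def B_def)
  have main: "(P ^^ (d + 1)) \<nu> x + ennreal (c * a) * \<nu> x \<le> \<nu> x + ennreal D" if x: "x \<in> Rd d" for x
  proof -
    have swap: "(P ^^ (d + 1)) \<nu> = (P ^^ d) (P \<nu>)"
      unfolding Suc_eq_plus1[symmetric] funpow_Suc_right by simp
    have "(P ^^ (d + 1)) \<nu> x + ennreal (c * a) * \<nu> x = (P ^^ d) (P \<nu>) x + ennreal c * (ennreal a * \<nu> x)"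
      unfolding swap using c a by (simp add: ennreal_mult mult.assoc)
    also have "\<dots> \<le> (P ^^ d) (P \<nu>) x + ennreal c * ((P ^^ d) (\<sigma> 1) x + ennreal B)"
      by (intro add_left_mono mult_left_mono aB x) simp
    also have "\<dots> = (P ^^ d) (\<lambda>y. P \<nu> y + ennreal c * \<sigma> 1 y) x + ennreal (c * B)"
      using x d1 c P.measurable_apply[of \<nu>]
      by (subst Pn.add) (auto simp: Pn.scale distrib_left add.assoc ennreal_mult B_def)
    also have "\<dots> \<le> (P ^^ d) (\<lambda>y. \<nu> y + ennreal C) x + ennreal (c * B)"
      using P x by (intro add_right_mono Pn.mono) auto
    also have "\<dots> = (P ^^ d) \<nu> x + (ennreal C + ennreal (c * B))"
      using x by (subst Pn.add) (auto simp: Pn.const add.assoc)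
    also have "\<dots> \<le> (\<nu> x + ennreal (d * C)) + (ennreal C + ennreal (c * B))"
      by (intro add_right_mono pow x)
    also have "\<dots> = \<nu> x + ennreal D"
      using c by (simp add: D_def B_def add.assoc distrib_right ennreal_plus[symmetric] del: ennreal_plus)
    finally show ?thesis .
  qed
  \<comment> \<open>The minimum ensures \<open>\<epsilon> < 1\<close>, so that the contraction factor \<open>1 - \<epsilon>\<close> is positive.\<close>
  define \<epsilon> where "\<epsilon> = min (c * a) (1 / 2)"
  have \<epsilon>: "0 < \<epsilon>" "\<epsilon> < 1" "\<epsilon> \<le> c * a" using c a by (simp_all add: \<epsilon>_def)
  show ?thesis
  proof (rule that)
    show "0 < 1 - \<epsilon>" "1 - \<epsilon> < 1" "0 < D + 1" using \<epsilon> D by simp_all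
    fix x assume x: "x \<in> Rd d"
    define N where "N = Rd_norm d x"
    have N: "N \<ge> 0" by (simp add: N_def)
    have fin: "(P ^^ (d + 1)) \<nu> x < top"
    proof -
      have "(P ^^ (d + 1)) \<nu> x \<le> \<nu> x + ennreal ((d + 1) * C)" using pow[OF x, of "d + 1"] by simp
      also have "\<dots> < top" by simp
      finally show ?thesis .
    qed
    then obtain r where r: "r \<ge> 0" "(P ^^ (d + 1)) \<nu> x = ennreal r"
      by (cases "(P ^^ (d + 1)) \<nu> x") auto
    have "ennreal (r + c * a * N) = ennreal r + ennreal (c * a) * ennreal N"
      using r N c a by (simp add: ennreal_mult)
    also have "\<dots> \<le> ennreal (N + D)" using main[OF x] N D r by (simp add: N_def)
    finally have "r + c * a * N \<le> N + D" using N D by (subst (asm) ennreal_le_iff) auto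
    moreover have "\<epsilon> * N \<le> c * a * N" using \<epsilon> N by (intro mult_right_mono) auto
    ultimately have rN: "r + 1 \<le> (1 - \<epsilon>) * (N + 1) + (D + 1)"
      using \<epsilon> by (simp add: algebra_simps)
    have "(P ^^ (d + 1)) (\<lambda>y. ennreal (lyapunov d y)) x = (P ^^ (d + 1)) (\<lambda>y. \<nu> y + 1) x"
      by (simp add: lyapunov_def del: funpow.simps)
    also have "\<dots> = (P ^^ (d + 1)) \<nu> x + 1"
      using x by (subst Pn.add) (auto simp: Pn.const)
    also have "\<dots> = ennreal (r + 1)" using r by simp
    also have "\<dots> \<le> ennreal ((1 - \<epsilon>) * lyapunov d x + (D + 1))"
      using rN by (intro ennreal_leI) (simp add: lyapunov_def N_def)
    finally show "(P ^^ (d + 1)) (\<lambda>y. ennreal (lyapunov d y)) x \<le> ennreal ((1 - \<epsilon>) * lyapunov d x + (D + 1))" .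
  qed
qed

section \<open>The Markov chain\<close>

text \<open>
  The noise lives on all lists of labels; lists that are no orders of the fields form a null set. Off
  this set the chain agrees with the iteration of the explicit flows, which is measurable.
\<close>

lemma AE_noise_perms: "AE \<omega> in noise d h. \<forall>n. fst (\<omega> n) \<in> perms"
proof -
  interpret T: prob_space "times (d + 1)" by (rule prob_space_times)
  interpret pair_sigma_finite "measure_pmf (pmf_of_set perms)" "times (d + 1)" ..
  have "AE z in step_noise d h. fst z \<in> perms"
    unfolding step_noise_eq
  proof (rule AE_pair_measure)
    have "fst \<in> measure_pmf (pmf_of_set perms) \<Otimes>\<^sub>M times (d + 1) \<rightarrow>\<^sub>M count_space UNIV"
      using measurable_fst[of "measure_pmf (pmf_of_set perms)" "times (d + 1)"] by simp
    from measurable_sets[OF this, of perms]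
    show "{z \<in> space (measure_pmf (pmf_of_set perms) \<Otimes>\<^sub>M times (d + 1)). fst z \<in> perms} \<in>
        sets (measure_pmf (pmf_of_set perms) \<Otimes>\<^sub>M times (d + 1))"
      by (simp add: vimage_def Int_def conj_commute)
    show "AE u in measure_pmf (pmf_of_set perms). AE \<tau> in times (d + 1). fst (u, \<tau>) \<in> perms"
      by (intro AE_pmfI) (simp add: finite_labels)
  qed
  then show ?thesis
    unfolding noise_def AE_all_countable
    by (intro allI AE_PiM_component prob_space_step_noise) auto
qed

abbreviation walk :: "(nat \<Rightarrow> step_noise) \<Rightarrow> nat \<Rightarrow> (nat \<Rightarrow> real) \<Rightarrow> nat \<Rightarrow> real" where
  "walk \<omega> n \<equiv> fold (\<lambda>k. step_map (\<omega> k)) [0..<n]"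

lemma fold_split_flow_in_Rd: "x \<in> Rd d \<Longrightarrow> fold (\<lambda>k. split_flow d \<beta> (u k) (\<tau> k)) ks x \<in> Rd d"
  by (induction ks arbitrary: x) (auto intro: split_flow_in_Rd)

lemma split_step_eq_step_map:
  assumes z: "fst z \<in> perms" and x: "x \<in> Rd d"
  shows "split_step d \<beta> z x = step_map z x"
proof -
  obtain u \<tau> where [simp]: "z = (u, \<tau>)" by (cases z)
  have "fold (\<lambda>k. flow d (split_field d \<beta> (u ! k)) (\<tau> k)) ks x = fold (\<lambda>k. split_flow d \<beta> (u ! k) (\<tau> k)) ks x"
    if "\<And>k. k \<in> set ks \<Longrightarrow> u ! k \<in> labels d" for ks
    using that x
  proof (induction ks arbitrary: x)
    case (Cons k ks)
    then show ?case by (simp add: flow_eq_split_flow[OF d] split_flow_in_Rd)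
  qed simp
  moreover have "u ! k \<in> labels d" if "k \<in> set [0..<d + 1]" for k
    using that z permsD[of u] nth_mem[of k u] by auto
  ultimately have "fold (\<lambda>k. flow d (split_field d \<beta> (u ! k)) (\<tau> k)) [0..<d + 1] x =
      fold (\<lambda>k. split_flow d \<beta> (u ! k) (\<tau> k)) [0..<d + 1] x"
    by blast
  then show ?thesis by (simp add: split_step_def step_map_def)
qed

lemma chain_eq_walk:
  assumes "\<And>n. fst (\<omega> n) \<in> perms" "x \<in> Rd d"
  shows "chain d \<beta> \<omega> x n = walk \<omega> n x \<and> walk \<omega> n x \<in> Rd d"
proof (induction n)
  case 0
  then show ?case using assms by simp
next
  case (Suc n)
  have "step_map z y \<in> Rd d" if "y \<in> Rd d" for z y
    using that by (cases z) (auto simp: step_map_def simp del: upt_Suc intro!: fold_split_flow_in_Rd)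
  then show ?case using Suc assms by (simp add: split_step_eq_step_map)
qed

lemma measurable_walk:
  assumes "x \<in> Rd d"
  shows "(\<lambda>\<omega>. walk \<omega> n x) \<in> noise d h \<rightarrow>\<^sub>M state d"
proof (induction n)
  case 0
  then show ?case using assms by simp
next
  case (Suc n)
  note [measurable] = Suc
  have [measurable]: "(\<lambda>\<omega>. \<omega> n) \<in> noise d h \<rightarrow>\<^sub>M step_noise d h"
    unfolding noise_def by (rule measurable_component_singleton) simp
  have "(\<lambda>\<omega>. (\<lambda>(z, x). step_map z x) (\<omega> n, walk \<omega> n x)) \<in> noise d h \<rightarrow>\<^sub>M state d"
    by (rule measurable_compose[OF _ measurable_step_map]) measurable
  then show ?case by simp
qed

text \<open>
  The Markov property: the sequence of noises has the same law as a single noise followed by an independent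
  such sequence, so the first step splits off.
\<close>

lemma nn_integral_walk:
  assumes \<phi>: "\<phi> \<in> borel_measurable (state d)" and x: "x \<in> Rd d"
  shows "(\<integral>\<^sup>+ \<omega>. \<phi> (walk \<omega> n x) \<partial>noise d h) = (P ^^ n) \<phi> x"
  using x
proof (induction n arbitrary: x)
  case 0
  interpret prob_space "noise d h" unfolding noise_def by (intro prob_space_PiM prob_space_step_noise)
  show ?case by (simp add: emeasure_space_1)
next
  case (Suc n)
  interpret M: prob_space "step_noise d h" by (rule prob_space_step_noise)
  interpret S: sequence_space "step_noise d h" ..
  interpret N: prob_space "noise d h" unfolding noise_def by (rule S.prob_space_axioms)
  let ?M = "step_noise d h" and ?N = "noise d h"
  let ?f = "\<lambda>\<omega>. \<phi> (walk \<omega> (Suc n) x)"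
  let ?c = "\<lambda>(s, \<omega>). case_nat s \<omega>"
  have f: "?f \<in> borel_measurable ?N"
    using measurable_walk[OF Suc.prems] \<phi> by (rule measurable_compose)
  have c: "?c \<in> ?M \<Otimes>\<^sub>M ?N \<rightarrow>\<^sub>M ?N" unfolding noise_def by measurable
  have "(\<integral>\<^sup>+ \<omega>. ?f \<omega> \<partial>?N) = (\<integral>\<^sup>+ \<omega>. ?f \<omega> \<partial>distr (?M \<Otimes>\<^sub>M ?N) ?N ?c)"
    using S.PiM_iter unfolding noise_def by simp
  also have "\<dots> = (\<integral>\<^sup>+ p. ?f (?c p) \<partial>(?M \<Otimes>\<^sub>M ?N))"
    by (rule nn_integral_distr[OF c]) (use f in simp)
  also have "\<dots> = (\<integral>\<^sup>+ z. \<integral>\<^sup>+ \<omega>. ?f (?c (z, \<omega>)) \<partial>?N \<partial>?M)"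
    by (rule N.nn_integral_fst[symmetric, OF measurable_compose[OF c f]])
  also have "\<dots> = (\<integral>\<^sup>+ z. (P ^^ n) \<phi> (step_map z x) \<partial>?M)"
  proof (intro nn_integral_cong)
    fix z assume "z \<in> space ?M"
    then have "step_map z x \<in> Rd d"
      using measurable_space[OF measurable_step_map, of "(z, x)"] Suc.prems by (simp add: space_pair_measure)
    moreover have "walk (case_nat z \<omega>) (Suc n) x = walk \<omega> n (step_map z x)" for \<omega>
    proof -
      have "[0..<Suc n] = 0 # map Suc [0..<n]" by (simp add: upt_conv_Cons map_Suc_upt del: upt_Suc)
      then show ?thesis by (simp add: fold_map o_def del: upt_Suc)
    qed
    ultimately show "(\<integral>\<^sup>+ \<omega>. ?f (?c (z, \<omega>)) \<partial>?N) = (P ^^ n) \<phi> (step_map z x)"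
      using Suc.IH by simp
  qed
  also have "\<dots> = (P ^^ Suc n) \<phi> x" by (simp add: avg_def)
  finally show ?case .
qed

lemma markov_semigroup_eq_P_pow:
  assumes \<phi>: "\<phi> \<in> borel_measurable (state d)" and x: "x \<in> Rd d"
  shows "markov_semigroup d \<beta> h n \<phi> x = (P ^^ n) \<phi> x"
proof -
  have "AE \<omega> in noise d h. \<phi> (chain d \<beta> \<omega> x n) = \<phi> (walk \<omega> n x)"
    using AE_noise_perms by eventually_elim (use x chain_eq_walk in simp)
  then show ?thesis
    unfolding markov_semigroup_def nn_integral_walk[OF \<phi> x, symmetric] by (rule nn_integral_cong_AE)
qed

end

theorem theorem3p11:
  shows "\<exists>h\<^sub>0::real. h\<^sub>0 > 0 \<and>
    (\<forall>d::nat. d \<ge> 4 \<longrightarrow>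
      (\<forall>\<beta>::nat \<Rightarrow> real. (\<forall>i\<in>{1..d}. \<beta> i \<noteq> 0) \<longrightarrow>
        (\<forall>h::real. 0 < h \<and> h \<le> h\<^sub>0 \<longrightarrow>
          (\<exists>\<alpha> f :: real. 0 < \<alpha> \<and> \<alpha> < 1 \<and> 0 < f \<and>
            (\<forall>x\<in>Rd d. markov_semigroup d \<beta> h (d + 1) (\<lambda>y. ennreal (lyapunov d y)) x
                        \<le> ennreal (\<alpha> * lyapunov d x + f))))))"
proof (rule exI[of _ 1], intro conjI allI impI)
  fix d :: nat and \<beta> :: "nat \<Rightarrow> real" and h :: real
  assume "d \<ge> 4" "\<forall>i\<in>{1..d}. \<beta> i \<noteq> 0" "0 < h \<and> h \<le> 1"
  then interpret lorenz_splitting d \<beta> h by unfold_locales auto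
  have m: "(\<lambda>y. ennreal (lyapunov d y)) \<in> borel_measurable (state d)"
    unfolding lyapunov_def by measurable
  obtain \<alpha> f where "0 < \<alpha>" "\<alpha> < 1" "0 < f"
    "\<And>x. x \<in> Rd d \<Longrightarrow> (P ^^ (d + 1)) (\<lambda>y. ennreal (lyapunov d y)) x \<le> ennreal (\<alpha> * lyapunov d x + f)"
    using P_pow_norm by blast
  then show "\<exists>\<alpha> f :: real. 0 < \<alpha> \<and> \<alpha> < 1 \<and> 0 < f \<and>
      (\<forall>x\<in>Rd d. markov_semigroup d \<beta> h (d + 1) (\<lambda>y. ennreal (lyapunov d y)) x \<le> ennreal (\<alpha> * lyapunov d x + f))"
    unfolding bex_simps using markov_semigroup_eq_P_pow[OF m] by (intro exI[of _ \<alpha>] exI[of _ f]) auto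
qed simp

end
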